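(* Every 3-connected cubic graph of tree-width 3 has a 3-decomposition.
   Context: All graphs are finite and simple; cubic means 3-regular. A 3-decomposition of a graph $G$ is a partition of $E(G)$ into the edge sets of a spanning tree, a (possibly empty) 2-regular subgraph, and a (possibly empty) matching. *)

theory Defs
  imports Main
begin

definition simple_graph :: "'a set \<Rightarrow> 'a set set \<Rightarrow> bool" where
  "simple_graph V E \<longleftrightarrow> finite V \<and>
     (\<forall>e\<in>E. \<exists>u v. u \<noteq> v \<and> u \<in> V \<and> v \<in> V \<and> e = {u, v})"

definition degree :: "'a set set \<Rightarrow> 'a \<Rightarrow> nat" where
  "degree E v = card {e\<in>E. v \<in> e}"

definition cubic :: "'a set \<Rightarrow> 'a set set \<Rightarrow> bool" where
  "cubic V E \<longleftrightarrow> (\<forall>v\<in>V. degree E v = 3)"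

definition reachable :: "'a set \<Rightarrow> 'a set set \<Rightarrow> 'a \<Rightarrow> 'a \<Rightarrow> bool" where
  "reachable S E u v \<longleftrightarrow>
     (\<lambda>x y. x \<in> S \<and> y \<in> S \<and> {x, y} \<in> E)\<^sup>*\<^sup>* u v"

definition connected_on :: "'a set \<Rightarrow> 'a set set \<Rightarrow> bool" where
  "connected_on S E \<longleftrightarrow> S \<noteq> {} \<and> (\<forall>u\<in>S. \<forall>v\<in>S. reachable S E u v)"

definition k_connected :: "nat \<Rightarrow> 'a set \<Rightarrow> 'a set set \<Rightarrow> bool" where
  "k_connected k V E \<longleftrightarrow> card V > k \<and>
     (\<forall>X. X \<subseteq> V \<and> card X < k \<longrightarrow> connected_on (V - X) E)"

text \<open>Acyclic: no edge lies on a cycle, i.e. the endpoints of every edge are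
not joined by a path avoiding that edge.\<close>
definition acyclic_on :: "'a set \<Rightarrow> 'a set set \<Rightarrow> bool" where
  "acyclic_on S E \<longleftrightarrow>
     (\<forall>u v. u \<noteq> v \<and> {u, v} \<in> E \<longrightarrow> \<not> reachable S (E - {{u, v}}) u v)"

definition is_tree :: "'a set \<Rightarrow> 'a set set \<Rightarrow> bool" where
  "is_tree S F \<longleftrightarrow> simple_graph S F \<and> connected_on S F \<and> acyclic_on S F"

definition tree_decomposition ::
  "'a set \<Rightarrow> 'a set set \<Rightarrow> nat set \<Rightarrow> nat set set \<Rightarrow> (nat \<Rightarrow> 'a set) \<Rightarrow> bool" where
  "tree_decomposition V E I F B \<longleftrightarrow>
     is_tree I F \<and>
     (\<forall>i\<in>I. B i \<subseteq> V) \<and>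
     (\<forall>v\<in>V. \<exists>i\<in>I. v \<in> B i) \<and>
     (\<forall>e\<in>E. \<exists>i\<in>I. e \<subseteq> B i) \<and>
     (\<forall>v\<in>V. connected_on {i\<in>I. v \<in> B i} F)"

definition td_width :: "nat set \<Rightarrow> (nat \<Rightarrow> 'a set) \<Rightarrow> nat" where
  "td_width I B = Max ((\<lambda>i. card (B i)) ` I) - 1"

definition treewidth :: "'a set \<Rightarrow> 'a set set \<Rightarrow> nat" where
  "treewidth V E =
     (LEAST k. \<exists>I F B. tree_decomposition V E I F B \<and> td_width I B = k)"

text \<open>3-decomposition: partition of E into the edge sets of a spanning tree,
a (possibly empty) 2-regular subgraph and a (possibly empty) matching.\<close>
definition three_decomposition :: "'a set \<Rightarrow> 'a set set \<Rightarrow> bool" where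
  "three_decomposition V E \<longleftrightarrow>
     (\<exists>T C M. T \<union> C \<union> M = E \<and> T \<inter> C = {} \<and> T \<inter> M = {} \<and> C \<inter> M = {} \<and>
        is_tree V T \<and>
        (\<forall>v\<in>V. degree C v = 0 \<or> degree C v = 2) \<and>
        (\<forall>v\<in>V. degree M v \<le> 1))"

end

theory Submission
  imports Defs
begin

text \<open>
  Call a set of vertices with exactly three boundary edges \<^emph>\<open>good\<close> if every admissible labelling
  of these edges (tree, tree, tree; tree, tree, matching; tree, cycle, cycle) extends to the edges
  inside so that the tree edges inside form a spanning tree. Starting from singletons, good sets are
  merged until only two are left; then one of the three edges between them becomes a tree edge and
  the other two become cycle edges. A merge is possible as long as there are at least three parts:
  the quotient is again a simple cubic graph of tree-width at most 3, hence it contains a triangle,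
  a \<open>K\<^sub>2\<^sub>,\<^sub>3\<close>, or a cube minus a vertex, and each of these has three boundary edges and is itself good.
\<close>

section \<open>Reachability and trees\<close>

text \<open>Asking a good set to extend every admissible labelling makes it as flexible as a single
  cubic vertex. Parts can then be contracted, and a configuration is settled in the quotient alone,
  by a finite choice of labels for the edges between its parts.

  The two properties of the quotient have different sources. It stays simple because every edge cut
  has at least three edges: two parts joined twice would have at most two boundary edges together.
  Its tree-width stays bounded because a good set is connected, so the quotient is a minor.

  Spanning trees are handled as connected sets with fewer edges than vertices. Acyclicity does not
  combine readily when parts are glued, whereas edge counts just add up.

  The last labelling is forced: two disjoint trees need exactly one joining edge, and only tree,
  cycle, cycle has a single tree edge.\<close>

lemma reachable_refl: "reachable S E x x"
  by (simp add: reachable_def)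

lemma reachable_trans: "reachable S E x y \<Longrightarrow> reachable S E y z \<Longrightarrow> reachable S E x z"
  unfolding reachable_def by (rule rtranclp_trans)

lemma reachable_edge: "x \<in> S \<Longrightarrow> y \<in> S \<Longrightarrow> {x, y} \<in> E \<Longrightarrow> reachable S E x y"
  unfolding reachable_def by blast

lemma reachable_induct [consumes 1, case_names refl step]:
  assumes "reachable S E x y" and "P x"
    and "\<And>y z. reachable S E x y \<Longrightarrow> y \<in> S \<Longrightarrow> z \<in> S \<Longrightarrow> {y, z} \<in> E \<Longrightarrow> P y \<Longrightarrow> P z"
  shows "P y"
  using assms(1) unfolding reachable_def
proof (induction rule: rtranclp_induct)
  case (step y z)
  then show ?case using assms(3)[of y z] by (simp add: reachable_def)
qed (rule assms(2))

lemma reachable_sym: "reachable S E x y \<Longrightarrow> reachable S E y x"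
proof (induction rule: reachable_induct)
  case (step y z)
  then have "reachable S E z y" by (intro reachable_edge) (auto simp: insert_commute)
  then show ?case using step.IH by (rule reachable_trans)
qed (rule reachable_refl)

lemma reachable_mono:
  assumes "reachable S E x y"
    and "\<And>u v. u \<in> S \<Longrightarrow> v \<in> S \<Longrightarrow> {u, v} \<in> E \<Longrightarrow> u \<in> S' \<and> v \<in> S' \<and> {u, v} \<in> E'"
  shows "reachable S' E' x y"
  using assms(1)
proof (induction rule: reachable_induct)
  case (step y z)
  then have "reachable S' E' y z" by (intro reachable_edge) (auto dest: assms(2))
  with step.IH show ?case by (rule reachable_trans)
qed (rule reachable_refl)

lemma connected_onI:
  assumes "r \<in> S" and "\<And>x. x \<in> S \<Longrightarrow> reachable S E r x"
  shows "connected_on S E"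
  using assms reachable_sym reachable_trans unfolding connected_on_def by (metis empty_iff)

text \<open>Grow a set from one vertex: as long as it is not all of \<open>S\<close>, some edge of
  \<open>F\<close> leaves it, and adding the far end gains one vertex and at least one inner
  edge.\<close>

lemma connected_card_le:
  assumes conn: "connected_on S F" and fin: "finite S" "finite F"
  shows "card S \<le> card F + 1"
proof -
  from conn obtain r where r: "r \<in> S" by (auto simp: connected_on_def)
  have "\<exists>S'\<subseteq>S. r \<in> S' \<and> card S' = Suc n \<and> Suc n \<le> card {e \<in> F. e \<subseteq> S'} + 1"
    if "Suc n \<le> card S" for n
    using that
  proof (induction n)
    case 0
    then show ?case using r by (intro exI[of _ "{r}"]) auto
  next
    case (Suc n)
    then obtain S' where S': "S' \<subseteq> S" "r \<in> S'" "card S' = Suc n"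
      "Suc n \<le> card {e \<in> F. e \<subseteq> S'} + 1" by auto
    then obtain w where w: "w \<in> S" "w \<notin> S'" using Suc.prems by (metis Suc_n_not_le_n subsetI subset_antisym)
    have "reachable S F r w" using conn r w by (auto simp: connected_on_def)
    then have "w \<in> S' \<or> (\<exists>x y. x \<in> S' \<and> y \<in> S \<and> y \<notin> S' \<and> {x, y} \<in> F)"
      by (induction rule: reachable_induct) (use S' in auto)
    then obtain x y where xy: "x \<in> S'" "y \<in> S" "y \<notin> S'" "{x, y} \<in> F" using w by blast
    have "card (insert {x, y} {e \<in> F. e \<subseteq> S'}) \<le> card {e \<in> F. e \<subseteq> insert y S'}"
      using xy fin by (intro card_mono) auto
    moreover have "card (insert {x, y} {e \<in> F. e \<subseteq> S'}) = Suc (card {e \<in> F. e \<subseteq> S'})"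
      using xy fin by (intro card_insert_disjoint) auto
    moreover have "card (insert y S') = Suc (Suc n)"
      using xy S' fin finite_subset by (metis card_insert_disjoint)
    ultimately show ?case using S' xy by (intro exI[of _ "insert y S'"]) auto
  qed
  moreover have "card S > 0" using r fin by (auto simp: card_gt_0_iff)
  ultimately obtain S' where S': "S' \<subseteq> S" "card S' = card S" "card S \<le> card {e \<in> F. e \<subseteq> S'} + 1"
    by (metis Suc_pred' le_refl)
  have "card {e \<in> F. e \<subseteq> S'} \<le> card F" using fin by (intro card_mono) auto
  with S' show ?thesis by linarith
qed

text \<open>Deleting an edge of a cycle keeps the set connected, and the remaining edges would be
  too few for \<open>connected_card_le\<close>.\<close>

lemma connected_few_edges_acyclic:
  assumes conn: "connected_on S F" and fin: "finite S" "finite F" and card: "card F < card S"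
  shows "acyclic_on S F"
  unfolding acyclic_on_def
proof (intro allI impI notI, elim conjE)
  fix u v assume uv: "u \<noteq> v" "{u, v} \<in> F" and r: "reachable S (F - {{u, v}}) u v"
  have "reachable S (F - {{u, v}}) x y" if "reachable S F x y" for x y
    using that
  proof (induction rule: reachable_induct)
    case (step y z)
    have "reachable S (F - {{u, v}}) y z"
    proof (cases "{y, z} = {u, v}")
      case True
      then show ?thesis using r reachable_sym by (metis doubleton_eq_iff)
    next
      case False
      then show ?thesis using step by (intro reachable_edge) auto
    qed
    then show ?case using step reachable_trans by metis
  qed (rule reachable_refl)
  then have "connected_on S (F - {{u, v}})"
    using conn by (auto simp: connected_on_def)
  then have "card S \<le> card (F - {{u, v}}) + 1" using fin by (intro connected_card_le) auto
  moreover have "card (F - {{u, v}}) + 1 = card F"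
    using uv fin by (metis Suc_eq_plus1 card.remove)
  ultimately show False using card by linarith
qed

section \<open>Cubic graphs of tree-width 3\<close>

text \<open>Each element of \<open>W\<close> owns a subtree of \<open>F\<close>; the intersection
  graph of subtrees is chordal, and this is its simplicial vertex. Take a directed tree edge
  \<open>(a, b)\<close> such that some subtree contains \<open>b\<close> but not \<open>a\<close>,
  with the component of \<open>b\<close> after deleting the edge as small as possible. A subtree
  that meets this one but misses \<open>b\<close> would provide such an edge with a smaller
  component.\<close>

lemma subtree_simplicial:
  assumes tree: "is_tree I F" and W: "W \<noteq> {}"
    and conn: "\<And>A. A \<in> W \<Longrightarrow> connected_on {i \<in> I. A \<in> D i} F"
  shows "\<exists>A\<in>W. \<exists>i\<in>I. A \<in> D i \<and> (\<forall>C\<in>W. \<forall>j\<in>I. A \<in> D j \<and> C \<in> D j \<longrightarrow> C \<in> D i)"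
proof -
  define side where "side = (\<lambda>(a, b). {x. reachable I (F - {{a, b}}) b x})"
  define cand where "cand = (\<lambda>(a, b). {a, b} \<in> F \<and> (\<exists>A\<in>W. A \<in> D b \<and> A \<notin> D a))"
  have finI: "finite I" and FI: "\<And>x y. {x, y} \<in> F \<Longrightarrow> x \<in> I \<and> y \<in> I"
    and connI: "connected_on I F" and acyc: "acyclic_on I F"
    using tree unfolding is_tree_def simple_graph_def by (auto simp: doubleton_eq_iff)
  show ?thesis
  proof (cases "\<exists>p. cand p")
    case False
    \<comment> \<open>Without a candidate edge no subtree stops anywhere, so each one fills the
      whole tree and any node serves.\<close>
    have *: "C \<in> D y" if "C \<in> W" "C \<in> D x" "{x, y} \<in> F" for C x y
    proof -
      have "\<not> cand (y, x)" using False by blast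
      then show ?thesis using that by (auto simp: cand_def insert_commute)
    qed
    have D_all: "C \<in> D y" if "reachable I F x y" "C \<in> W" "C \<in> D x" for C x y
      using that
    proof (induction rule: reachable_induct)
      case (step y z)
      from step.prems have "C \<in> D y" by (rule step.IH)
      then show ?case using * step.prems(1) step.hyps(4) by metis
    qed
    obtain A where A: "A \<in> W" using W by blast
    then obtain i where "i \<in> I" "A \<in> D i" using conn[OF A] by (auto simp: connected_on_def)
    moreover have "C \<in> D i" if "C \<in> W" "j \<in> I" "C \<in> D j" for C j
    proof (rule D_all)
      show "reachable I F j i" using connI that \<open>i \<in> I\<close> by (simp add: connected_on_def)
    qed (use that in auto)
    ultimately show ?thesis using A by metis
  next
    case True
    then obtain p0 where "cand p0" by (elim exE)
    from ex_has_least_nat[of cand, OF this, of "\<lambda>q. card (side q)"]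
    obtain p where p: "cand p" and pmin: "\<And>q. cand q \<Longrightarrow> card (side p) \<le> card (side q)"
      by auto
    obtain a b where pab: "p = (a, b)" by (cases p)
    then obtain A where ab: "{a, b} \<in> F" and A: "A \<in> W" "A \<in> D b" "A \<notin> D a"
      using p by (auto simp: cand_def)
    have "C \<in> D b" if C: "C \<in> W" "j \<in> I" "A \<in> D j" "C \<in> D j" for C j
    proof (rule ccontr)
      assume Cb: "C \<notin> D b"
      have "reachable {i \<in> I. A \<in> D i} F b j"
        using conn[OF A(1)] C A FI[OF ab] by (auto simp: connected_on_def)
      \<comment> \<open>The walk from \<open>b\<close> to \<open>j\<close> inside the subtree of
        \<open>A\<close> starts outside the subtree of \<open>C\<close> and ends in it;
        \<open>{c, c'}\<close> is the first entering edge. It differs from \<open>{a, b}\<close>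
        because the subtree of \<open>A\<close> avoids \<open>a\<close>.\<close>
      then have "\<exists>c c'. reachable {i \<in> I. C \<notin> D i} (F - {{a, b}}) b c \<and> {c, c'} \<in> F \<and>
           C \<notin> D c \<and> C \<in> D c' \<and> {c, c'} \<noteq> {a, b}" (is "\<exists>c c'. ?exit c c'")
      proof (rule contrapos_pp)
        assume none: "\<not> (\<exists>c c'. ?exit c c')"
        have "C \<notin> D x \<and> reachable {i \<in> I. C \<notin> D i} (F - {{a, b}}) b x"
          if "reachable {i \<in> I. A \<in> D i} F b x" for x
          using that
        proof (induction rule: reachable_induct)
          case (step y z)
          then have yz: "{y, z} \<noteq> {a, b}" using A by (auto simp: doubleton_eq_iff)
          have Cz: "C \<notin> D z"
          proof
            assume "C \<in> D z"
            then have "?exit y z" using step yz by simp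
            then show False using none by (elim notE) (intro exI)
          qed
          have "reachable {i \<in> I. C \<notin> D i} (F - {{a, b}}) y z"
            using Cz step yz by (intro reachable_edge) auto
          with conjunct2[OF step.IH] have "reachable {i \<in> I. C \<notin> D i} (F - {{a, b}}) b z"
            by (rule reachable_trans)
          with Cz show ?case by (rule conjI)
        qed (use Cb in \<open>simp add: reachable_refl\<close>)
        then show "\<not> reachable {i \<in> I. A \<in> D i} F b j" using C by auto
      qed
      then obtain c c' where bc: "reachable {i \<in> I. C \<notin> D i} (F - {{a, b}}) b c"
        and cc: "{c, c'} \<in> F" "C \<notin> D c" "C \<in> D c'" "{c, c'} \<noteq> {a, b}"
        by (elim exE conjE)
      \<comment> \<open>The walk from \<open>b\<close> to \<open>c\<close> avoids the subtree of
        \<open>C\<close> and hence the edge to \<open>c'\<close>. If \<open>b\<close> were also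
        reachable from \<open>c'\<close> without that edge, the edge would lie on a cycle.\<close>
      have b_out: "b \<notin> side (c, c')"
      proof
        assume "b \<in> side (c, c')"
        then have "reachable I (F - {{c, c'}}) c' b" by (simp add: side_def)
        moreover have "reachable I (F - {{c, c'}}) b c"
          using bc by (rule reachable_mono) (use cc in \<open>auto simp: doubleton_eq_iff\<close>)
        ultimately have "reachable I (F - {{c', c}}) c' c"
          using reachable_trans by (metis insert_commute)
        then show False using acyc cc unfolding acyclic_on_def by (metis insert_commute)
      qed
      \<comment> \<open>A walk beyond \<open>c'\<close> never meets \<open>b\<close>, so it cannot
        use \<open>{a, b}\<close>. The inclusion is proper because \<open>b\<close> itself is left
        out, which contradicts minimality.\<close>
      have "side (c, c') \<subseteq> side (a, b)"
      proof
        fix x assume "x \<in> side (c, c')"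
        then have "reachable I (F - {{c, c'}}) c' x" by (simp add: side_def)
        then have "reachable I (F - {{a, b}}) c' x"
        proof (induction rule: reachable_induct)
          case (step y z)
          have "reachable I (F - {{c, c'}}) c' z"
            using step reachable_edge reachable_trans by metis
          then have "y \<noteq> b" "z \<noteq> b" using step b_out by (auto simp: side_def)
          then have "reachable I (F - {{a, b}}) y z"
            using step by (intro reachable_edge) (auto simp: doubleton_eq_iff)
          then show ?case using step reachable_trans by metis
        qed (rule reachable_refl)
        moreover have "reachable I (F - {{a, b}}) b c"
          using bc by (rule reachable_mono) auto
        moreover have "reachable I (F - {{a, b}}) c c'"
          using cc FI[OF cc(1)] by (intro reachable_edge) auto
        ultimately have "reachable I (F - {{a, b}}) b x" using reachable_trans by metis
        then show "x \<in> side (a, b)" by (simp add: side_def)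
      qed
      moreover have "b \<in> side (a, b)" by (simp add: side_def reachable_refl)
      moreover have "side (a, b) \<subseteq> I"
      proof
        fix x assume "x \<in> side (a, b)"
        then have "reachable I (F - {{a, b}}) b x" by (simp add: side_def)
        then show "x \<in> I" by (induction rule: reachable_induct) (use FI[OF ab] in auto)
      qed
      ultimately have "card (side (c, c')) < card (side p)"
        using b_out finI pab by (metis finite_subset psubsetI psubset_card_mono)
      moreover have "cand (c, c')" using cc C by (auto simp: cand_def)
      ultimately show False using pmin[of "(c, c')"] by simp
    qed
    then show ?thesis using A FI[OF ab] by (intro bexI[of _ A] bexI[of _ b]) auto
  qed
qed

text \<open>The set \<open>L\<close> below plays the role of the leaves of a 3-tree containing the graph, and
  \<open>u\<close> is a leaf of what remains when \<open>L\<close> is deleted; at \<open>u\<close> the graph looks like one of the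
  left-hand sides of the Arnborg--Proskurowski reduction rules for tree-width 3.\<close>
lemma cubic_width3_config:
  fixes N :: "'b \<Rightarrow> 'b set"
  assumes tree: "is_tree I F" and P: "P \<noteq> {}"
    and conn: "\<And>A. A \<in> P \<Longrightarrow> connected_on {i \<in> I. A \<in> D i} F"
    and width: "\<And>i. i \<in> I \<Longrightarrow> D i \<subseteq> P \<and> finite (D i) \<and> card (D i) \<le> 4"
    and N: "\<And>A. A \<in> P \<Longrightarrow> N A \<subseteq> P \<and> card (N A) = 3 \<and> A \<notin> N A"
    and sym: "\<And>A B. A \<in> P \<Longrightarrow> B \<in> N A \<Longrightarrow> A \<in> N B"
    and cover: "\<And>A B. A \<in> P \<Longrightarrow> B \<in> N A \<Longrightarrow> \<exists>i\<in>I. A \<in> D i \<and> B \<in> D i"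
    and triangle_free: "\<And>a b c. a \<in> P \<Longrightarrow> b \<in> N a \<Longrightarrow> c \<in> N a \<Longrightarrow> c \<notin> N b"
  shows "(\<exists>a\<in>P. \<exists>b\<in>P. a \<noteq> b \<and> N a = N b) \<or>
    (\<exists>u x y z p q r. u \<in> P \<and> N u = {x, y, z} \<and> N x = {u, q, r} \<and> N y = {u, p, r} \<and> N z = {u, p, q})"
    (is "?twins \<or> ?cube")
proof (rule ccontr)
  assume contr: "\<not> ?thesis"
  have no_cube: "\<not> ?cube" using contr by (rule contrapos_nn) (rule disjI2)
  have no_twins: "\<not> ?twins" using contr by (rule contrapos_nn) (rule disjI1)
  have twinfree: "a = b" if ab: "a \<in> P" "b \<in> P" "N a = N b" for a b
  proof (rule ccontr)
    assume "a \<noteq> b"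
    then have "a \<noteq> b \<and> N a = N b" using ab(3) by (rule conjI)
    then have ?twins using ab(1,2) by (intro bexI)
    with no_twins show False by contradiction
  qed
  define L where "L = {v \<in> P. \<exists>i\<in>I. v \<in> D i \<and> (\<forall>C\<in>P. \<forall>j\<in>I. v \<in> D j \<and> C \<in> D j \<longrightarrow> C \<in> D i)}"
  have finN: "finite (N a)" if "a \<in> P" for a
    using N[OF that] by (metis card.infinite zero_neq_numeral)
  have leaf: "\<exists>i\<in>I. D i = insert v (N v)" "\<And>j. j \<in> I \<Longrightarrow> v \<in> D j \<Longrightarrow> D j \<subseteq> insert v (N v)"
    if v: "v \<in> L" for v
  proof -
    have vP: "v \<in> P" using v by (simp add: L_def)
    from v have "\<exists>i\<in>I. v \<in> D i \<and> (\<forall>C\<in>P. \<forall>j\<in>I. v \<in> D j \<and> C \<in> D j \<longrightarrow> C \<in> D i)"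
      by (simp add: L_def)
    then obtain i where i: "i \<in> I" "v \<in> D i"
      and all: "\<forall>C\<in>P. \<forall>j\<in>I. v \<in> D j \<and> C \<in> D j \<longrightarrow> C \<in> D i" by (elim bexE conjE)
    have "w \<in> D i" if w: "w \<in> N v" for w
    proof -
      obtain j where "j \<in> I" "v \<in> D j" "w \<in> D j" using cover[OF vP w] by (elim bexE conjE)
      moreover have "w \<in> P" using N[OF vP] w by auto
      ultimately show ?thesis using all by blast
    qed
    then have "insert v (N v) \<subseteq> D i" using i by auto
    \<comment> \<open>A vertex with its three neighbours already fills a bag of the largest allowed
      size.\<close>
    moreover have "card (insert v (N v)) = 4" using N[OF vP] finN[OF vP] by simp
    ultimately have eq: "D i = insert v (N v)" using width[OF i(1)] by (metis card_seteq)
    then show "\<exists>i\<in>I. D i = insert v (N v)" using i by auto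
    fix j assume j: "j \<in> I" "v \<in> D j"
    show "D j \<subseteq> insert v (N v)"
    proof
      fix C assume "C \<in> D j"
      moreover from this have "C \<in> P" using width[OF j(1)] by auto
      ultimately have "C \<in> D i" using all j by blast
      then show "C \<in> insert v (N v)" using eq by simp
    qed
  qed
  have LP: "L \<subseteq> P" by (auto simp: L_def)
  \<comment> \<open>If adjacent \<open>v\<close> and \<open>w\<close> were both in \<open>L\<close>,
    the bag of \<open>v\<close> would lie in the closed neighbourhood of \<open>w\<close>, and a
    further neighbour of \<open>v\<close> would close a triangle.\<close>
  have indep: "w \<notin> L" if v: "v \<in> L" "w \<in> N v" for v w
  proof
    assume w: "w \<in> L"
    obtain i where i: "i \<in> I" "D i = insert v (N v)" using leaf[OF v(1)] by blast
    then have "insert v (N v) \<subseteq> insert w (N w)" using leaf(2)[OF w i(1)] v by auto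
    moreover have "\<exists>c\<in>N v. c \<noteq> w"
    proof (rule ccontr)
      assume "\<not> ?thesis"
      then have "card (N v) \<le> card {w}" by (intro card_mono) auto
      then show False using N v LP by auto
    qed
    ultimately obtain c where "c \<in> N v" "c \<in> N w" by blast
    then show False using triangle_free[of v w c] v LP by blast
  qed
  have W: "P - L \<noteq> {}"
  proof
    assume "P - L = {}"
    then have PL: "P = L" using LP by blast
    obtain v where v: "v \<in> P" using P by blast
    then have "N v \<noteq> {}" using N[OF v] by auto
    then show False using indep[of v] v N[OF v] PL by blast
  qed
  \<comment> \<open>All vertices outside \<open>L\<close> that share a bag with \<open>u\<close> lie
    in the one bag \<open>D i\<close>. Besides \<open>u\<close> there are at most three of them, and
    \<open>K\<close> contains them all.\<close>
  obtain u i where u: "u \<in> P" "u \<notin> L" "i \<in> I" "u \<in> D i"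
    and simp: "\<And>C j. C \<in> P \<Longrightarrow> C \<notin> L \<Longrightarrow> j \<in> I \<Longrightarrow> u \<in> D j \<Longrightarrow> C \<in> D j \<Longrightarrow> C \<in> D i"
    using subtree_simplicial[OF tree W, of D] conn by blast
  define K where "K = D i - {u}"
  have finK: "finite K" and cardK: "card K \<le> 3" using width[OF u(3)] u by (auto simp: K_def)
  have NuK: "w \<in> K" if "w \<in> N u" "w \<notin> L" for w
    using cover[OF u(1) that(1)] simp[of w] N[OF u(1)] that u by (auto simp: K_def)
  \<comment> \<open>The bag of \<open>v\<close> contains \<open>u\<close>, and the other neighbours
    of \<open>v\<close> are outside \<open>L\<close> by \<open>indep\<close>; hence they belong to
    \<open>K\<close>.\<close>
  have leafK: "N v - {u} \<subseteq> K \<and> card (N v - {u}) = 2" if v: "v \<in> N u" "v \<in> L" for v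
  proof -
    have uv: "u \<in> N v" using v sym u by blast
    obtain j where j: "j \<in> I" "D j = insert v (N v)" using leaf v by blast
    have "w \<in> K" if "w \<in> N v" "w \<noteq> u" for w
      using simp[of w j] indep[OF v(2) that(1)] that j uv N[of v] v LP by (auto simp: K_def)
    moreover have "card (N v - {u}) = 2" using uv N[of v] v LP finN[of v] by auto
    ultimately show ?thesis by blast
  qed
  \<comment> \<open>If \<open>u\<close> had no neighbour in \<open>L\<close>, everything sharing a
    bag with \<open>u\<close> would lie in \<open>D i\<close>, and \<open>u\<close> itself would
    belong to \<open>L\<close>.\<close>
  have ex: "\<exists>v. v \<in> N u \<and> v \<in> L"
  proof (rule ccontr)
    assume none: "\<not> ?thesis"
    have "C \<in> D i" if C: "C \<in> P" "j \<in> I" "u \<in> D j" "C \<in> D j" for C j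
    proof (cases "C \<in> L")
      case True
      then have "u \<in> insert C (N C)" using leaf(2) C by blast
      then have "u \<in> N C" using True u by auto
      then have "C \<in> N u" using sym C by blast
      then show ?thesis using none True by blast
    qed (use simp C in blast)
    then have "u \<in> L" using u by (auto simp: L_def)
    then show False using u by blast
  qed
  then obtain v where v: "v \<in> N u" "v \<in> L" by blast
  \<comment> \<open>A neighbour \<open>w\<close> of \<open>u\<close> outside \<open>L\<close> would
    fill \<open>K\<close> together with the two other neighbours of \<open>v\<close>. The third
    neighbour \<open>t\<close> of \<open>u\<close> would then be a twin of \<open>v\<close> if it is
    in \<open>L\<close>, and adjacent to \<open>v\<close> otherwise.\<close>
  have NuL: "N u \<subseteq> L"
  proof
    fix w assume w: "w \<in> N u"
    show "w \<in> L"
    proof (rule ccontr)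
      assume wL: "w \<notin> L"
      have "w \<notin> N v" using triangle_free[OF u(1) v(1) w] .
      moreover have "w \<in> K" using NuK w wL by blast
      ultimately have "insert w (N v - {u}) \<subseteq> K" "card (insert w (N v - {u})) = 3"
        using leafK[OF v] finite_subset[OF _ finK, of "N v - {u}"] by auto
      then have K: "K = insert w (N v - {u})" using finK cardK by (metis card_seteq)
      have "\<exists>t\<in>N u. t \<noteq> v \<and> t \<noteq> w"
      proof (rule ccontr)
        assume "\<not> ?thesis"
        then have "card (N u) \<le> card {v, w}" by (intro card_mono) auto
        then show False using N[OF u(1)] card_insert_le_m1[of 2 "{w}" v] by auto
      qed
      then obtain t where t: "t \<in> N u" "t \<noteq> v" "t \<noteq> w" by blast
      show False
      proof (cases "t \<in> L")
        case True
        have "w \<notin> N t" using triangle_free[OF u(1) t(1) w] .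
        then have "N t - {u} \<subseteq> N v - {u}" using leafK[OF t(1) True] K by blast
        then have "N t - {u} = N v - {u}"
          using leafK[OF t(1) True] leafK[OF v] finK by (metis card_subset_eq finite_subset)
        moreover have "u \<in> N t" "u \<in> N v" using sym u v t by auto
        ultimately have "N t = N v" by blast
        then show False using twinfree t v N u by blast
      next
        case False
        then have "t \<in> N v" using NuK t K by blast
        then show False using triangle_free[OF u(1) v(1) t(1)] by blast
      qed
    qed
  qed
  obtain x y z where xyz: "N u = {x, y, z}" "x \<noteq> y" "y \<noteq> z" "x \<noteq> z"
    using N[OF u(1)] by (metis card_3_iff)
  have Lxyz: "x \<in> L" "y \<in> L" "z \<in> L" using NuL xyz by auto
  \<comment> \<open>If the two further neighbours of \<open>s\<close> exhausted \<open>K\<close>,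
    all neighbours of \<open>u\<close> would be twins. So each neighbour of \<open>u\<close> is
    adjacent to all but one of three elements of \<open>K\<close>, and by twin-freeness the missed
    ones differ: a cube without the vertex opposite to \<open>u\<close>.\<close>
  have miss: "\<exists>p\<in>K. N s = insert u (K - {p})" if s: "s \<in> N u" for s
  proof -
    have sL: "s \<in> L" using s NuL by blast
    have us: "u \<in> N s" using s sym u by blast
    have "N s - {u} \<noteq> K"
    proof
      assume eq: "N s - {u} = K"
      obtain t where t: "t \<in> N u" "t \<noteq> s" using xyz by auto
      then have tL: "t \<in> L" using NuL by blast
      have "N t - {u} = N s - {u}" using leafK[OF t(1) tL] leafK[OF s sL] eq finK
        by (metis card_subset_eq)
      moreover have "u \<in> N t" using sym u t by auto
      ultimately have "N t = N s" using us by blast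
      then show False using twinfree t s N u by blast
    qed
    then obtain p where p: "p \<in> K" "p \<notin> N s" using leafK[OF s sL] by (auto simp: K_def)
    then have "N s - {u} \<subseteq> K - {p}" "card (K - {p}) \<le> card (N s - {u})"
      using leafK[OF s sL] cardK finK by auto
    then have "N s - {u} = K - {p}" using finK by (intro card_seteq) auto
    then show ?thesis using p us by blast
  qed
  have "\<exists>p\<in>K. N x = insert u (K - {p})" "\<exists>q\<in>K. N y = insert u (K - {q})"
    "\<exists>r\<in>K. N z = insert u (K - {r})" using miss xyz by blast+
  then obtain p q r where pqr: "p \<in> K" "q \<in> K" "r \<in> K"
    and Nx: "N x = insert u (K - {p})" and Ny: "N y = insert u (K - {q})"
    and Nz: "N z = insert u (K - {r})" by blast
  have "x \<in> P" "y \<in> P" "z \<in> P" using Lxyz LP by auto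
  then have d: "p \<noteq> q" "q \<noteq> r" "p \<noteq> r"
    using twinfree[of x y] twinfree[of y z] twinfree[of x z] Nx Ny Nz xyz by auto
  have "{p, q, r} \<subseteq> K" "card {p, q, r} = 3" using pqr d by auto
  then have K: "K = {p, q, r}" using finK cardK by (metis card_seteq)
  have "N x = {u, q, r}" "N y = {u, p, r}" "N z = {u, p, q}"
    using Nx Ny Nz K d by auto
  then have ?cube using u xyz(1) by (intro exI conjI)
  then show False using no_cube by contradiction
qed

section \<open>Gluing labelled parts\<close>

datatype label = Tree | Cycle | Matching

text \<open>Up to the order of \<open>b\<close> and \<open>c\<close>, these are the labels that a 3-decomposition can induce on the
  three edges at a vertex.\<close>
definition ordered_labels :: "('e \<Rightarrow> label) \<Rightarrow> 'e \<Rightarrow> 'e \<Rightarrow> 'e \<Rightarrow> bool" where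
  "ordered_labels L a b c \<longleftrightarrow> L a = Tree \<and>
     (L b = Tree \<and> L c = Tree \<or> L b = Tree \<and> L c = Matching \<or> L b = Cycle \<and> L c = Cycle)"

definition valid :: "('e \<Rightarrow> label) \<Rightarrow> 'e set \<Rightarrow> bool" where
  "valid L D \<longleftrightarrow> (\<exists>a b c. D = {a, b, c} \<and> a \<noteq> b \<and> a \<noteq> c \<and> b \<noteq> c \<and> ordered_labels L a b c)"

lemma valid_cong:
  assumes "\<And>e. e \<in> D \<Longrightarrow> L e = L' e"
  shows "valid L D = valid L' D"
proof -
  have "valid L2 D" if valid: "valid L1 D" and eq: "\<And>e. e \<in> D \<Longrightarrow> L1 e = L2 e"
    for L1 L2 :: "'a \<Rightarrow> label"
  proof -
    obtain a b c where abc: "D = {a, b, c}" "a \<noteq> b" "a \<noteq> c" "b \<noteq> c" "ordered_labels L1 a b c"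
      using valid unfolding valid_def by blast
    then have "L1 a = L2 a" "L1 b = L2 b" "L1 c = L2 c" using eq by auto
    then have "ordered_labels L2 a b c" using abc(5) by (simp add: ordered_labels_def)
    then show ?thesis using abc unfolding valid_def by blast
  qed
  then show ?thesis using assms by metis
qed

lemma valid_orders:
  assumes "valid L {a, b, c}"
  shows "ordered_labels L a b c \<or> ordered_labels L a c b \<or> ordered_labels L b a c \<or>
    ordered_labels L b c a \<or> ordered_labels L c a b \<or> ordered_labels L c b a"
proof -
  obtain x y z where xyz: "{a, b, c} = {x, y, z}" "x \<noteq> y" "x \<noteq> z" "y \<noteq> z"
    and o: "ordered_labels L x y z" using assms unfolding valid_def by auto
  have "x \<in> {a, b, c}" "y \<in> {a, b, c}" "z \<in> {a, b, c}" using xyz by auto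
  then show ?thesis using o xyz(2-4) by auto
qed

lemma valid_triple:
  assumes "a \<noteq> b" "a \<noteq> c" "b \<noteq> c"
  shows "valid L {a, b, c} \<longleftrightarrow> ordered_labels L a b c \<or> ordered_labels L a c b \<or>
    ordered_labels L b a c \<or> ordered_labels L b c a \<or> ordered_labels L c a b \<or>
    ordered_labels L c b a" (is "_ \<longleftrightarrow> ?orders")
proof
  have perm: "valid L {a, b, c}" if "ordered_labels L x y z" "{a, b, c} = {x, y, z}"
    "x \<noteq> y" "x \<noteq> z" "y \<noteq> z" for x y z using that unfolding valid_def by blast
  assume ?orders
  then show "valid L {a, b, c}"
    using assms perm[of a b c] perm[of a c b] perm[of b a c] perm[of b c a] perm[of c a b]
      perm[of c b a] by (auto simp: insert_commute)
qed (rule valid_orders)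

definition boundary :: "'a set set \<Rightarrow> 'a set \<Rightarrow> 'a set set" where
  "boundary E S = {e \<in> E. e \<inter> S \<noteq> {} \<and> \<not> e \<subseteq> S}"

definition tree_edges :: "'a set set \<Rightarrow> ('a set \<Rightarrow> label) \<Rightarrow> 'a set \<Rightarrow> 'a set set" where
  "tree_edges E L X = {e \<in> E. e \<subseteq> X \<and> L e = Tree}"

text \<open>Only the values of \<open>L\<close> on the boundary matter; inside \<open>X\<close> the
  labelling \<open>L'\<close> is free. In a simple graph \<open>boundary E {v}\<close> is the set of
  edges at \<open>v\<close>. The last two conjuncts encode a spanning tree of \<open>X\<close>, see
  \<open>connected_few_edges_acyclic\<close>.\<close>

definition extension ::
  "'a set set \<Rightarrow> ('a set \<Rightarrow> label) \<Rightarrow> 'a set \<Rightarrow> ('a set \<Rightarrow> label) \<Rightarrow> bool" where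
  "extension E L X L' \<longleftrightarrow> (\<forall>e\<in>boundary E X. L' e = L e) \<and> (\<forall>v\<in>X. valid L' (boundary E {v})) \<and>
     connected_on X (tree_edges E L' X) \<and> card (tree_edges E L' X) < card X"

definition good :: "'a set set \<Rightarrow> 'a set \<Rightarrow> bool" where
  "good E X \<longleftrightarrow> finite X \<and> card (boundary E X) = 3 \<and>
     (\<forall>L. valid L (boundary E X) \<longrightarrow> (\<exists>L'. extension E L X L'))"

lemma good_nonempty: "good E X \<Longrightarrow> X \<noteq> {}"
  by (auto simp: good_def boundary_def)

text \<open>Three tree labels are admissible on the boundary, and the tree edges of the resulting
  extension already connect \<open>X\<close>. Connected parts are what lets a tree decomposition
  pass to the quotient.\<close>

lemma good_connected:
  assumes "good E X"
  shows "connected_on X E"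
proof -
  obtain a b c where "boundary E X = {a, b, c}" "a \<noteq> b" "a \<noteq> c" "b \<noteq> c"
    using assms unfolding good_def by (metis card_3_iff)
  then have "valid (\<lambda>_. Tree) (boundary E X)" by (simp add: valid_triple ordered_labels_def)
  then obtain L where "connected_on X (tree_edges E L X)"
    using assms unfolding good_def extension_def by metis
  then show ?thesis
    unfolding connected_on_def using reachable_mono[of X "tree_edges E L X" _ _ X E]
    by (auto simp: tree_edges_def)
qed

lemma good_singleton:
  assumes "card (boundary E {v}) = 3" "\<And>e. e \<in> E \<Longrightarrow> card e = 2"
  shows "good E {v}"
  unfolding good_def
proof (intro conjI allI impI exI)
  fix L assume "valid L (boundary E {v})"
  moreover have "tree_edges E L {v} = {}"
  proof -
    have "card e \<noteq> 2" if "e \<subseteq> {v}" for e :: "'a set"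
      using card_mono[OF _ that] by simp
    then show ?thesis using assms(2) by (auto simp: tree_edges_def)
  qed
  ultimately show "extension E L {v} L"
    by (auto simp: extension_def connected_on_def reachable_refl)
qed (use assms in auto)

text \<open>Here \<open>L\<close> is a labelling of the quotient with vertex set \<open>Q\<close>,
  and \<open>conn\<close> states through closed sets that its tree edges connect the quotient. Each
  part adds inner labels from its own extension. Less than \<open>card A\<close> tree edges inside
  each \<open>A\<close> and less than \<open>card Q\<close> between parts make less than
  \<open>card (\<Union>Q)\<close> in total.\<close>

lemma glue:
  assumes simple: "\<And>e. e \<in> E \<Longrightarrow> card e = 2" and finE: "finite E"
    and finQ: "finite Q" and good: "\<And>A. A \<in> Q \<Longrightarrow> good E A"
    and disj: "\<And>A B. A \<in> Q \<Longrightarrow> B \<in> Q \<Longrightarrow> A \<noteq> B \<Longrightarrow> A \<inter> B = {}"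
    and valid: "\<And>A. A \<in> Q \<Longrightarrow> valid L (boundary E A)"
    and r: "r \<in> Q"
    and conn: "\<And>S. r \<in> S \<Longrightarrow> (\<And>A B e. A \<in> Q \<Longrightarrow> B \<in> Q \<Longrightarrow> A \<in> S \<Longrightarrow> e \<in> boundary E A \<Longrightarrow>
        e \<in> boundary E B \<Longrightarrow> L e = Tree \<Longrightarrow> B \<in> S) \<Longrightarrow> Q \<subseteq> S"
    and few: "card {e \<in> (\<Union>A\<in>Q. boundary E A) - boundary E (\<Union>Q). L e = Tree} < card Q"
  shows "\<exists>L'. extension E L (\<Union>Q) L'"
proof -
  have "\<exists>L'. extension E L A L'" if "A \<in> Q" for A
    using good[OF that] valid[OF that] by (simp add: good_def)
  then obtain LA where LA: "\<And>A. A \<in> Q \<Longrightarrow> extension E L A (LA A)" by metis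
  \<comment> \<open>An edge lies inside at most one part, so the description is unique where it is
    used; edges between parts and on the outer boundary keep their label.\<close>
  define L' where "L' e = (if \<exists>A\<in>Q. e \<subseteq> A then LA (THE A. A \<in> Q \<and> e \<subseteq> A) e else L e)" for e
  have nonempty: "e \<noteq> {}" if "e \<in> E" for e using simple[OF that] by auto
  have inner: "L' e = LA A e" if e: "e \<in> E" "A \<in> Q" "e \<subseteq> A" for e A
  proof -
    have "(THE A. A \<in> Q \<and> e \<subseteq> A) = A"
    proof (rule the_equality)
      fix B assume "B \<in> Q \<and> e \<subseteq> B"
      then show "B = A" using disj[of A B] nonempty[OF e(1)] e by auto
    qed (use e in simp)
    then show ?thesis using e by (auto simp: L'_def)
  qed
  have bd_not_inner: "\<not> e \<subseteq> B" if e: "A \<in> Q" "B \<in> Q" "e \<in> boundary E A" for e A B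
  proof
    assume "e \<subseteq> B"
    then have "A \<inter> B \<noteq> {}" using e by (auto simp: boundary_def)
    then have "A = B" using disj e by metis
    then show False using e \<open>e \<subseteq> B\<close> by (auto simp: boundary_def)
  qed
  have outer: "L' e = L e" if "A \<in> Q" "e \<in> boundary E A" for e A
    using bd_not_inner that by (auto simp: L'_def)
  have bdU: "\<exists>A\<in>Q. e \<in> boundary E A" if "e \<in> boundary E (\<Union>Q)" for e
    using that by (auto simp: boundary_def)
  have validL': "valid L' (boundary E {v})" if v: "A \<in> Q" "v \<in> A" for A v
  proof -
    have "L' e = LA A e" if "e \<in> boundary E {v}" for e
    proof (cases "e \<subseteq> A")
      case True
      then show ?thesis using that v inner by (auto simp: boundary_def)
    next
      case False
      then have "e \<in> boundary E A" using that v by (auto simp: boundary_def)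
      then show ?thesis using LA[OF v(1)] outer v by (auto simp: extension_def)
    qed
    then show ?thesis using LA[OF v(1)] v(2) valid_cong[of "boundary E {v}" L' "LA A"]
      by (auto simp: extension_def)
  qed
  let ?T = "tree_edges E L' (\<Union>Q)"
  have part_edges: "tree_edges E (LA A) A \<subseteq> ?T" if "A \<in> Q" for A
    using inner that by (auto simp: tree_edges_def)
  have part_conn: "reachable (\<Union>Q) ?T x y" if xy: "A \<in> Q" "x \<in> A" "y \<in> A" for A x y
  proof -
    have "reachable A (tree_edges E (LA A) A) x y"
      using LA[OF xy(1)] xy by (auto simp: extension_def connected_on_def)
    then show ?thesis by (rule reachable_mono) (use part_edges xy in auto)
  qed
  obtain v0 where v0: "v0 \<in> r" using good_nonempty[OF good[OF r]] by blast
  \<comment> \<open>The parts that are reachable from \<open>v0\<close> as a whole include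
    \<open>r\<close> and are closed under tree edges between parts, so \<open>conn\<close> applies
    to them.\<close>
  have "Q \<subseteq> {A \<in> Q. \<forall>x\<in>A. reachable (\<Union>Q) ?T v0 x}"
  proof (rule conn)
    show "r \<in> {A \<in> Q. \<forall>x\<in>A. reachable (\<Union>Q) ?T v0 x}" using r v0 part_conn by auto
  next
    fix A B e
    assume AB: "A \<in> Q" "B \<in> Q" "A \<in> {A \<in> Q. \<forall>x\<in>A. reachable (\<Union>Q) ?T v0 x}"
      and e: "e \<in> boundary E A" "e \<in> boundary E B" "L e = Tree"
    have reach: "reachable (\<Union>Q) ?T v0 x" if "x \<in> A" for x using AB that by auto
    show "B \<in> {A \<in> Q. \<forall>x\<in>A. reachable (\<Union>Q) ?T v0 x}"
    proof (cases "A = B")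
      case False
      obtain x y where x: "x \<in> e" "x \<in> A" and y: "y \<in> e" "y \<in> B"
        using e by (auto simp: boundary_def)
      have "x \<noteq> y" using disj[OF AB(1,2) False] x y by auto
      moreover have "card e = 2" using e simple by (auto simp: boundary_def)
      ultimately have exy: "e = {x, y}" using x y by (auto simp: card_2_iff)
      have "e \<in> ?T" using e exy x y AB outer[OF AB(1) e(1)]
        by (auto simp: tree_edges_def boundary_def)
      then have "reachable (\<Union>Q) ?T x y" using x y AB exy by (intro reachable_edge) auto
      then have "reachable (\<Union>Q) ?T v0 y" using reach[OF x(2)] reachable_trans by metis
      then have "reachable (\<Union>Q) ?T v0 z" if "z \<in> B" for z
        using part_conn[OF AB(2) y(2) that] by (rule reachable_trans)
      then show ?thesis using AB by simp
    qed (use AB in simp)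
  qed
  then have "reachable (\<Union>Q) ?T v0 x" if "x \<in> \<Union>Q" for x using that by auto
  then have connT: "connected_on (\<Union>Q) ?T" using v0 r by (intro connected_onI[of v0]) auto
  let ?I = "{e \<in> (\<Union>A\<in>Q. boundary E A) - boundary E (\<Union>Q). L e = Tree}"
  have "?T \<subseteq> (\<Union>A\<in>Q. tree_edges E (LA A) A) \<union> ?I"
  proof
    fix e assume "e \<in> ?T"
    then have e: "e \<in> E" "e \<subseteq> \<Union>Q" "L' e = Tree" by (auto simp: tree_edges_def)
    show "e \<in> (\<Union>A\<in>Q. tree_edges E (LA A) A) \<union> ?I"
    proof (cases "\<exists>A\<in>Q. e \<subseteq> A")
      case True
      then show ?thesis using e inner by (auto simp: tree_edges_def)
    next
      case False
      obtain v A where vA: "v \<in> e" "v \<in> A" "A \<in> Q" using e nonempty[OF e(1)] by blast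
      then have A: "A \<in> Q" "e \<in> boundary E A" using False e by (auto simp: boundary_def)
      then have "L e = Tree" using outer e by metis
      then show ?thesis using A e by (auto simp: boundary_def)
    qed
  qed
  moreover have finT: "finite (tree_edges E l A)" for l A using finE by (simp add: tree_edges_def)
  moreover have "finite ?I" using finE finQ by (auto simp: boundary_def)
  ultimately have "card ?T \<le> card (\<Union>A\<in>Q. tree_edges E (LA A) A) + card ?I"
    using finQ by (meson card_Un_le card_mono finite_UN_I finite_UnI le_trans)
  also have "card (\<Union>A\<in>Q. tree_edges E (LA A) A) \<le> (\<Sum>A\<in>Q. card (tree_edges E (LA A) A))"
    using finQ by (rule card_UN_le)
  \<comment> \<open>The inner tree of \<open>A\<close> has at most \<open>card A - 1\<close> edges.
    Crediting one more edge to each part pays for the edges between parts, and the strict bound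
    \<open>few\<close> survives to the end.\<close>
  finally have "card ?T < (\<Sum>A\<in>Q. card (tree_edges E (LA A) A)) + card Q" using few by linarith
  also have "\<dots> = (\<Sum>A\<in>Q. card (tree_edges E (LA A) A) + 1)" by (simp add: sum_Suc)
  also have "\<dots> \<le> (\<Sum>A\<in>Q. card A)"
    using LA by (intro sum_mono) (auto simp: extension_def Suc_le_eq)
  also have "\<dots> = card (\<Union>Q)"
    using good disj finQ by (intro card_Union_disjoint[symmetric])
      (auto simp: pairwise_def disjnt_def good_def)
  finally have "card ?T < card (\<Union>Q)" .
  moreover have "L' e = L e" if "e \<in> boundary E (\<Union>Q)" for e
    using bdU[OF that] outer by metis
  ultimately show ?thesis
    using connT validL' unfolding extension_def by (intro exI[of _ L']) auto
qed

text \<open>The closure condition on \<open>S\<close> says that the tree edges connect the parts in \<open>Q\<close>, and the bound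
  on \<open>es\<close> that they do so without redundancy.\<close>
definition quotient_extension ::
  "'a set set \<Rightarrow> 'a set set \<Rightarrow> ('a set \<Rightarrow> label) \<Rightarrow> ('a set \<Rightarrow> label) \<Rightarrow> bool" where
  "quotient_extension E Q L L' \<longleftrightarrow>
     (\<forall>e\<in>boundary E (\<Union>Q). L' e = L e) \<and> (\<forall>A\<in>Q. valid L' (boundary E A)) \<and>
     (\<exists>r\<in>Q. \<forall>S. r \<in> S \<longrightarrow> (\<forall>A\<in>Q. \<forall>B\<in>Q. A \<in> S \<longrightarrow>
        (\<exists>e\<in>boundary E A. e \<in> boundary E B \<and> L' e = Tree) \<longrightarrow> B \<in> S) \<longrightarrow> Q \<subseteq> S) \<and>
     (\<exists>es. {e \<in> (\<Union>A\<in>Q. boundary E A) - boundary E (\<Union>Q). L' e = Tree} \<subseteq> set es \<and>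
        length es < card Q)"

lemma quotient_extension_glue:
  assumes simple: "\<And>e. e \<in> E \<Longrightarrow> card e = 2" and finE: "finite E"
    and finQ: "finite Q" and good: "\<And>A. A \<in> Q \<Longrightarrow> good E A"
    and disj: "\<And>A B. A \<in> Q \<Longrightarrow> B \<in> Q \<Longrightarrow> A \<noteq> B \<Longrightarrow> A \<inter> B = {}"
    and ext: "quotient_extension E Q L L'"
  shows "\<exists>L''. extension E L (\<Union>Q) L''"
proof -
  obtain r es where r: "r \<in> Q"
    and conn: "\<forall>S. r \<in> S \<longrightarrow> (\<forall>A\<in>Q. \<forall>B\<in>Q. A \<in> S \<longrightarrow>
        (\<exists>e\<in>boundary E A. e \<in> boundary E B \<and> L' e = Tree) \<longrightarrow> B \<in> S) \<longrightarrow> Q \<subseteq> S"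
    and es: "{e \<in> (\<Union>A\<in>Q. boundary E A) - boundary E (\<Union>Q). L' e = Tree} \<subseteq> set es"
      "length es < card Q"
    using ext unfolding quotient_extension_def by (elim conjE bexE exE)
  have "\<exists>L''. extension E L' (\<Union>Q) L''"
  proof (rule glue[OF simple finE finQ good disj _ r])
    show "valid L' (boundary E A)" if "A \<in> Q" for A
      using ext that unfolding quotient_extension_def by simp
    show "Q \<subseteq> S" if S: "r \<in> S" and step: "\<And>A B e. A \<in> Q \<Longrightarrow> B \<in> Q \<Longrightarrow> A \<in> S \<Longrightarrow>
        e \<in> boundary E A \<Longrightarrow> e \<in> boundary E B \<Longrightarrow> L' e = Tree \<Longrightarrow> B \<in> S" for S
    proof (rule conn[rule_format, OF S])
      fix A B assume "A \<in> Q" "B \<in> Q" "A \<in> S"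
        "\<exists>e\<in>boundary E A. e \<in> boundary E B \<and> L' e = Tree"
      then show "B \<in> S" using step[of A B] by metis
    qed
    \<comment> \<open>The length of \<open>es\<close> bounds the number of tree edges without any
      argument that its entries are distinct.\<close>
    have "card {e \<in> (\<Union>A\<in>Q. boundary E A) - boundary E (\<Union>Q). L' e = Tree} \<le> card (set es)"
      using es by (intro card_mono) auto
    then show "card {e \<in> (\<Union>A\<in>Q. boundary E A) - boundary E (\<Union>Q). L' e = Tree} < card Q"
      using es card_length[of es] by linarith
  qed
  then show ?thesis using ext unfolding quotient_extension_def extension_def by auto
qed

text \<open>An edge has only two ends: if it leaves the union, one end lies in a single part and the
  other in none, while an edge between two parts is on both boundaries. So the boundary of a merged
  set can be read off from those of its parts.\<close>

lemma boundary_Union_disjoint: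
  assumes simple: "\<And>e. e \<in> E \<Longrightarrow> card e = 2"
    and disj: "\<And>A B. A \<in> Q \<Longrightarrow> B \<in> Q \<Longrightarrow> A \<noteq> B \<Longrightarrow> A \<inter> B = {}"
  shows "boundary E (\<Union>Q) = {e. \<exists>A\<in>Q. e \<in> boundary E A \<and> (\<forall>B\<in>Q. e \<in> boundary E B \<longrightarrow> B = A)}"
    (is "_ = ?R")
proof (intro equalityI subsetI)
  fix e assume e: "e \<in> boundary E (\<Union>Q)"
  then have "card e = 2" using simple by (auto simp: boundary_def)
  then obtain x y where "e = {x, y}" by (auto simp: card_2_iff)
  then obtain x y where exy: "e = {x, y}" "x \<in> \<Union>Q" "y \<notin> \<Union>Q"
    using e unfolding boundary_def by (auto simp: insert_commute)
  then obtain A where A: "A \<in> Q" "x \<in> A" by blast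
  then have "e \<in> boundary E A" using e exy by (auto simp: boundary_def)
  moreover have "B = A" if "B \<in> Q" "e \<in> boundary E B" for B
    using that A exy disj[of A B] by (auto simp: boundary_def)
  ultimately show "e \<in> ?R" using A by blast
next
  fix e assume "e \<in> ?R"
  then obtain A where A: "A \<in> Q" "e \<in> boundary E A"
    and un: "\<And>B. B \<in> Q \<Longrightarrow> e \<in> boundary E B \<Longrightarrow> B = A" by blast
  have "\<not> e \<subseteq> \<Union>Q"
  proof
    assume "e \<subseteq> \<Union>Q"
    moreover obtain y where "y \<in> e" "y \<notin> A" using A by (auto simp: boundary_def)
    ultimately obtain B where y: "y \<in> e" "y \<notin> A" "B \<in> Q" "y \<in> B" by blast
    moreover from this have "A \<inter> B = {}" using disj A by metis
    ultimately have "e \<in> boundary E B" using A by (auto simp: boundary_def)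
    then show False using un y by blast
  qed
  then show "e \<in> boundary E (\<Union>Q)" using A by (auto simp: boundary_def)
qed

text \<open>With all edges listed in \<open>S\<close> and those at just one part in
  \<open>R\<close>, the condition \<open>outer\<close> becomes a finite check for the
  simplifier.\<close>

lemma boundary_UnionI:
  assumes simple: "\<And>e. e \<in> E \<Longrightarrow> card e = 2"
    and disj: "\<And>A B. A \<in> Q \<Longrightarrow> B \<in> Q \<Longrightarrow> A \<noteq> B \<Longrightarrow> A \<inter> B = {}"
    and es: "\<Union>(boundary E ` Q) = S"
    and outer: "\<forall>e\<in>S. (\<exists>A\<in>Q. e \<in> boundary E A \<and> (\<forall>B\<in>Q. e \<in> boundary E B \<longrightarrow> B = A)) \<longleftrightarrow> e \<in> R"
    and "R \<subseteq> S"
  shows "boundary E (\<Union>Q) = R"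
proof -
  have eq: "boundary E (\<Union>Q) = {e. \<exists>A\<in>Q. e \<in> boundary E A \<and> (\<forall>B\<in>Q. e \<in> boundary E B \<longrightarrow> B = A)}"
    using simple disj by (rule boundary_Union_disjoint)
  show ?thesis
  proof (rule set_eqI)
    fix e
    show "e \<in> boundary E (\<Union>Q) \<longleftrightarrow> e \<in> R"
    proof (cases "e \<in> S")
      case True
      then show ?thesis using outer by (simp add: eq)
    next
      case False
      then have "e \<notin> R" "\<forall>A\<in>Q. e \<notin> boundary E A" using assms(5) es by auto
      then show ?thesis by (simp add: eq)
    qed
  qed
qed

section \<open>The three configurations\<close>

lemma quotient_extensionI:
  assumes "\<forall>e\<in>boundary E (\<Union>Q). L' e = L e" and "\<forall>A\<in>Q. valid L' (boundary E A)" and "r \<in> Q"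
    and "\<forall>S. r \<in> S \<longrightarrow> (\<forall>A\<in>Q. \<forall>B\<in>Q. A \<in> S \<longrightarrow>
        (\<exists>e\<in>boundary E A. e \<in> boundary E B \<and> L' e = Tree) \<longrightarrow> B \<in> S) \<longrightarrow> Q \<subseteq> S"
    and "{e \<in> (\<Union>A\<in>Q. boundary E A) - boundary E (\<Union>Q). L' e = Tree} \<subseteq> set es"
    and "length es < card Q"
  shows "\<exists>L'. quotient_extension E Q L L'"
proof (rule exI)
  show "quotient_extension E Q L L'"
    unfolding quotient_extension_def
  proof (intro conjI)
    show "\<exists>r\<in>Q. \<forall>S. r \<in> S \<longrightarrow> (\<forall>A\<in>Q. \<forall>B\<in>Q. A \<in> S \<longrightarrow>
        (\<exists>e\<in>boundary E A. e \<in> boundary E B \<and> L' e = Tree) \<longrightarrow> B \<in> S) \<longrightarrow> Q \<subseteq> S"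
      using assms(4,3) by (rule bexI)
    show "\<exists>es. {e \<in> (\<Union>A\<in>Q. boundary E A) - boundary E (\<Union>Q). L' e = Tree} \<subseteq> set es \<and>
        length es < card Q"
      using conjI[OF assms(5,6)] by (rule exI[of _ es])
  qed (fact assms(1,2))+
qed

text \<open>All three configurations are symmetric in their outer edges. The label lemmas therefore
  treat one order of roles, and the six cases here are filled by renaming parts and edges.\<close>

lemma good_of_orders:
  assumes simple: "\<And>e. e \<in> E \<Longrightarrow> card e = 2" and finE: "finite E"
    and finQ: "finite Q" and good: "\<And>A. A \<in> Q \<Longrightarrow> good E A"
    and disj: "\<And>A B. A \<in> Q \<Longrightarrow> B \<in> Q \<Longrightarrow> A \<noteq> B \<Longrightarrow> A \<inter> B = {}"
    and bdQ: "boundary E (\<Union>Q) = {e1, e2, e3}" and dist: "distinct [e1, e2, e3]"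
    and orders: "\<And>L. ordered_labels L e1 e2 e3 \<Longrightarrow> \<exists>L'. quotient_extension E Q L L'"
      "\<And>L. ordered_labels L e1 e3 e2 \<Longrightarrow> \<exists>L'. quotient_extension E Q L L'"
      "\<And>L. ordered_labels L e2 e1 e3 \<Longrightarrow> \<exists>L'. quotient_extension E Q L L'"
      "\<And>L. ordered_labels L e2 e3 e1 \<Longrightarrow> \<exists>L'. quotient_extension E Q L L'"
      "\<And>L. ordered_labels L e3 e1 e2 \<Longrightarrow> \<exists>L'. quotient_extension E Q L L'"
      "\<And>L. ordered_labels L e3 e2 e1 \<Longrightarrow> \<exists>L'. quotient_extension E Q L L'"
  shows "good E (\<Union>Q)"
  unfolding good_def
proof (intro conjI allI impI)
  show "finite (\<Union>Q)" using finQ good by (auto simp: good_def)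
  show "card (boundary E (\<Union>Q)) = 3" using bdQ dist by simp
  fix L assume "valid L (boundary E (\<Union>Q))"
  then have "valid L {e1, e2, e3}" by (simp only: bdQ)
  then have "\<exists>L'. quotient_extension E Q L L'"
    using orders[of L] by (auto dest!: valid_orders)
  then obtain L' where "quotient_extension E Q L L'" by (elim exE)
  from quotient_extension_glue[OF simple finE finQ good disj this]
  show "\<exists>L'. extension E L (\<Union>Q) L'" .
qed

text \<open>The pattern of all three label lemmas: if \<open>e2\<close> and \<open>e3\<close> are
  cycle edges, the cycle enters at one, passes through the parts and leaves at the other, while the
  tree spans all parts without its edges. Otherwise the inner tree is a Hamiltonian path from the
  part at \<open>e1\<close> to the part at \<open>e2\<close>, and the remaining inner edges form a
  matching that misses only the part at \<open>e3\<close>. Hence \<open>e3\<close> may be a tree or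
  a matching edge.\<close>

lemma triangle_labels:
  assumes ord: "ordered_labels L e1 e2 e3" and Q: "Q = {a, b, c}"
    and bd: "boundary E a = {f, g, e1}" "boundary E b = {f, h, e2}" "boundary E c = {g, h, e3}"
    and bdQ: "boundary E (\<Union>Q) = {e1, e2, e3}"
    and dist: "distinct [a, b, c]" "distinct [f, g, h, e1, e2, e3]"
  shows "\<exists>L'. quotient_extension E Q L L'"
proof -
  \<comment> \<open>Reversing the lists yields each inequality in the opposite orientation as well,
    so that simplification can use both.\<close>
  have "distinct [e3, e2, e1, h, g, f]" "distinct [c, b, a]"
    using dist distinct_rev[of "[f, g, h, e1, e2, e3]"] distinct_rev[of "[a, b, c]"]
    by (simp_all only: rev.simps append.simps)
  note neq = this[simplified] dist[simplified]
  show ?thesis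
  proof (cases "L e2 = Cycle")
    case True
    then have L: "L e1 = Tree" "L e2 = Cycle" "L e3 = Cycle"
      using ord by (auto simp: ordered_labels_def)
    let ?L = "L(f := Tree, g := Tree, h := Cycle)"
    show ?thesis
    proof (rule quotient_extensionI[where r = a and L' = ?L], unfold bdQ)
      show "\<forall>A\<in>Q. valid ?L (boundary E A)"
        using L by (auto simp add: neq Q bd valid_triple ordered_labels_def)
      show "{e \<in> (\<Union>A\<in>Q. boundary E A) - {e1, e2, e3}. ?L e = Tree} \<subseteq> set [f, g]"
        by (auto simp: neq Q bd)
    qed (use L in \<open>simp_all add: neq Q bd\<close>)
  next
    case False
    then have L: "L e1 = Tree" "L e2 = Tree" "L e3 = Tree \<or> L e3 = Matching"
      using ord by (auto simp: ordered_labels_def)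
    let ?L = "L(f := Matching, g := Tree, h := Tree)"
    show ?thesis
    proof (rule quotient_extensionI[where r = c and L' = ?L], unfold bdQ)
      show "\<forall>A\<in>Q. valid ?L (boundary E A)"
        using L by (auto simp add: neq Q bd valid_triple ordered_labels_def)
      show "{e \<in> (\<Union>A\<in>Q. boundary E A) - {e1, e2, e3}. ?L e = Tree} \<subseteq> set [g, h]"
        by (auto simp: neq Q bd)
    qed (use L in \<open>simp_all add: neq Q bd\<close>)
  qed
qed

text \<open>Here the parts form a \<open>K\<^sub>2\<^sub>,\<^sub>3\<close> with sides \<open>b1, b2\<close> and \<open>a1, a2, a3\<close>.\<close>
lemma twin_labels:
  assumes ord: "ordered_labels L e1 e2 e3" and Q: "Q = {a1, a2, a3, b1, b2}"
    and bd: "boundary E a1 = {f11, f21, e1}" "boundary E a2 = {f12, f22, e2}"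
      "boundary E a3 = {f13, f23, e3}" "boundary E b1 = {f11, f12, f13}" "boundary E b2 = {f21, f22, f23}"
    and bdQ: "boundary E (\<Union>Q) = {e1, e2, e3}"
    and dist: "distinct [a1, a2, a3, b1, b2]" "distinct [f11, f12, f13, f21, f22, f23, e1, e2, e3]"
  shows "\<exists>L'. quotient_extension E Q L L'"
proof -
  have "distinct [e3, e2, e1, f23, f22, f21, f13, f12, f11]" "distinct [b2, b1, a3, a2, a1]"
    using dist distinct_rev[of "[f11, f12, f13, f21, f22, f23, e1, e2, e3]"] distinct_rev[of "[a1, a2, a3, b1, b2]"]
    by (simp_all only: rev.simps append.simps)
  note neq = this[simplified] dist[simplified]
  show ?thesis
  proof (cases "L e2 = Cycle")
    case True
    then have L: "L e1 = Tree" "L e2 = Cycle" "L e3 = Cycle"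
      using ord by (auto simp: ordered_labels_def)
    \<comment> \<open>The cycle runs through \<open>a2\<close>, \<open>b1\<close>,
      \<open>a3\<close>; the tree is the star at \<open>b2\<close> with \<open>b1\<close> attached
      to \<open>a1\<close>.\<close>
    let ?L = "L(f11 := Tree, f12 := Cycle, f13 := Cycle, f21 := Tree, f22 := Tree, f23 := Tree)"
    show ?thesis
    proof (rule quotient_extensionI[where r = b2 and L' = ?L], unfold bdQ)
      show "\<forall>A\<in>Q. valid ?L (boundary E A)"
        using L by (auto simp add: neq Q bd valid_triple ordered_labels_def)
      show "{e \<in> (\<Union>A\<in>Q. boundary E A) - {e1, e2, e3}. ?L e = Tree} \<subseteq> set [f11, f21, f22, f23]"
        by (auto simp: neq Q bd)
    qed (use L in \<open>simp_all add: neq Q bd\<close>)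
  next
    case False
    then have L: "L e1 = Tree" "L e2 = Tree" "L e3 = Tree \<or> L e3 = Matching"
      using ord by (auto simp: ordered_labels_def)
    \<comment> \<open>The tree path is \<open>a1\<close>, \<open>b2\<close>, \<open>a3\<close>,
      \<open>b1\<close>, \<open>a2\<close>; the matching is \<open>f11\<close>,
      \<open>f22\<close>.\<close>
    let ?L = "L(f11 := Matching, f12 := Tree, f13 := Tree, f21 := Tree, f22 := Matching, f23 := Tree)"
    show ?thesis
    proof (rule quotient_extensionI[where r = a3 and L' = ?L], unfold bdQ)
      show "\<forall>A\<in>Q. valid ?L (boundary E A)"
        using L by (auto simp add: neq Q bd valid_triple ordered_labels_def)
      show "{e \<in> (\<Union>A\<in>Q. boundary E A) - {e1, e2, e3}. ?L e = Tree} \<subseteq> set [f12, f13, f21, f23]"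
        by (auto simp: neq Q bd)
    qed (use L in \<open>simp_all add: neq Q bd\<close>)
  qed
qed

text \<open>Here the parts form a cube minus the vertex opposite to \<open>u\<close>.\<close>
lemma cube_labels:
  assumes ord: "ordered_labels L e1 e2 e3" and Q: "Q = {u, x, y, z, p, q, r}"
    and bd: "boundary E u = {ux, uy, uz}"
      "boundary E x = {ux, xq, xr}" "boundary E y = {uy, yp, yr}" "boundary E z = {uz, zp, zq}"
      "boundary E p = {yp, zp, e1}" "boundary E q = {xq, zq, e2}" "boundary E r = {xr, yr, e3}"
    and bdQ: "boundary E (\<Union>Q) = {e1, e2, e3}"
    and dist: "distinct [u, x, y, z, p, q, r]" "distinct [ux, uy, uz, xq, xr, yp, yr, zp, zq, e1, e2, e3]"
  shows "\<exists>L'. quotient_extension E Q L L'"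
proof -
  have "distinct [e3, e2, e1, zq, zp, yr, yp, xr, xq, uz, uy, ux]" "distinct [r, q, p, z, y, x, u]"
    using dist distinct_rev[of "[ux, uy, uz, xq, xr, yp, yr, zp, zq, e1, e2, e3]"] distinct_rev[of "[u, x, y, z, p, q, r]"]
    by (simp_all only: rev.simps append.simps)
  note neq = this[simplified] dist[simplified]
  show ?thesis
  proof (cases "L e2 = Cycle")
    case True
    then have L: "L e1 = Tree" "L e2 = Cycle" "L e3 = Cycle"
      using ord by (auto simp: ordered_labels_def)
    \<comment> \<open>The cycle runs through \<open>q\<close>, \<open>x\<close>, \<open>r\<close>.
      The tree has three branches at \<open>z\<close>: to \<open>u\<close> and \<open>x\<close>, to
      \<open>q\<close>, and to \<open>p\<close>, \<open>y\<close> and \<open>r\<close>.\<close>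
    let ?L = "L(ux := Tree, uy := Matching, uz := Tree, xq := Cycle, xr := Cycle, yp := Tree, yr := Tree, zp := Tree, zq := Tree)"
    show ?thesis
    proof (rule quotient_extensionI[where r = u and L' = ?L], unfold bdQ)
      show "\<forall>A\<in>Q. valid ?L (boundary E A)"
        using L by (auto simp add: neq Q bd valid_triple ordered_labels_def)
      show "{e \<in> (\<Union>A\<in>Q. boundary E A) - {e1, e2, e3}. ?L e = Tree} \<subseteq> set [ux, uz, yp, yr, zp, zq]"
        by (auto simp: neq Q bd)
    qed (use L in \<open>simp_all add: neq Q bd\<close>)
  next
    case False
    then have L: "L e1 = Tree" "L e2 = Tree" "L e3 = Tree \<or> L e3 = Matching"
      using ord by (auto simp: ordered_labels_def)
    \<comment> \<open>The tree path is \<open>p\<close>, \<open>z\<close>, \<open>u\<close>,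
      \<open>y\<close>, \<open>r\<close>, \<open>x\<close>, \<open>q\<close>; the matching is
      \<open>ux\<close>, \<open>yp\<close>, \<open>zq\<close>.\<close>
    let ?L = "L(ux := Matching, uy := Tree, uz := Tree, xq := Tree, xr := Tree, yp := Matching, yr := Tree, zp := Tree, zq := Matching)"
    show ?thesis
    proof (rule quotient_extensionI[where r = u and L' = ?L], unfold bdQ)
      show "\<forall>A\<in>Q. valid ?L (boundary E A)"
        using L by (auto simp add: neq Q bd valid_triple ordered_labels_def)
      show "{e \<in> (\<Union>A\<in>Q. boundary E A) - {e1, e2, e3}. ?L e = Tree} \<subseteq> set [uy, uz, xq, xr, yr, zp]"
        by (auto simp: neq Q bd)
    qed (use L in \<open>simp_all add: neq Q bd\<close>)
  qed
qed

lemma good_triangle: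
  assumes simple: "\<And>e. e \<in> E \<Longrightarrow> card e = 2" and finE: "finite E"
    and Q: "Q = {a, b, c}" and good: "\<And>A. A \<in> Q \<Longrightarrow> good E A"
    and disj: "\<And>A B. A \<in> Q \<Longrightarrow> B \<in> Q \<Longrightarrow> A \<noteq> B \<Longrightarrow> A \<inter> B = {}"
    and bd: "boundary E a = {f, g, e1}" "boundary E b = {f, h, e2}" "boundary E c = {g, h, e3}"
    and dist: "distinct [a, b, c]" "distinct [f, g, h, e1, e2, e3]"
  shows "good E (\<Union>Q)"
proof -
  have "distinct [e3, e2, e1, h, g, f]" "distinct [c, b, a]"
    using dist distinct_rev[of "[f, g, h, e1, e2, e3]"] distinct_rev[of "[a, b, c]"]
    by (simp_all only: rev.simps append.simps)
  note neq = this[simplified] dist[simplified]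
  have bdQ: "boundary E (\<Union>Q) = {e1, e2, e3}"
  proof (rule boundary_UnionI[OF simple disj])
    show "\<Union>(boundary E ` Q) = {f, g, h, e1, e2, e3}" by (auto simp: Q bd)
    show "\<forall>e\<in>{f, g, h, e1, e2, e3}. (\<exists>A\<in>Q. e \<in> boundary E A \<and> (\<forall>B\<in>Q. e \<in> boundary E B \<longrightarrow> B = A)) \<longleftrightarrow>
        e \<in> {e1, e2, e3}"
      by (simp add: Q bd neq)
  qed auto
  have finQ: "finite Q" by (simp add: Q)
  have dist': "distinct [e1, e2, e3]" using dist(2) by simp
  show ?thesis
  proof (rule good_of_orders[OF simple finE finQ good disj bdQ dist'])
    fix L :: "'a set \<Rightarrow> label"
    show "\<exists>L'. quotient_extension E Q L L'" if "ordered_labels L e1 e2 e3"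
      using that
      by (rule triangle_labels[of L e1 e2 e3 Q a b c E f g h])
        ((rule trans[OF bdQ], simp add: insert_commute) | (rule trans[OF Q], simp add: insert_commute) |
          (simp add: neq; fail) | simp add: bd insert_commute)+
    show "\<exists>L'. quotient_extension E Q L L'" if "ordered_labels L e1 e3 e2"
      using that
      by (rule triangle_labels[of L e1 e3 e2 Q a c b E g f h])
        ((rule trans[OF bdQ], simp add: insert_commute) | (rule trans[OF Q], simp add: insert_commute) |
          (simp add: neq; fail) | simp add: bd insert_commute)+
    show "\<exists>L'. quotient_extension E Q L L'" if "ordered_labels L e2 e1 e3"
      using that
      by (rule triangle_labels[of L e2 e1 e3 Q b a c E f h g])
        ((rule trans[OF bdQ], simp add: insert_commute) | (rule trans[OF Q], simp add: insert_commute) |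
          (simp add: neq; fail) | simp add: bd insert_commute)+
    show "\<exists>L'. quotient_extension E Q L L'" if "ordered_labels L e2 e3 e1"
      using that
      by (rule triangle_labels[of L e2 e3 e1 Q b c a E h f g])
        ((rule trans[OF bdQ], simp add: insert_commute) | (rule trans[OF Q], simp add: insert_commute) |
          (simp add: neq; fail) | simp add: bd insert_commute)+
    show "\<exists>L'. quotient_extension E Q L L'" if "ordered_labels L e3 e1 e2"
      using that
      by (rule triangle_labels[of L e3 e1 e2 Q c a b E g h f])
        ((rule trans[OF bdQ], simp add: insert_commute) | (rule trans[OF Q], simp add: insert_commute) |
          (simp add: neq; fail) | simp add: bd insert_commute)+
    show "\<exists>L'. quotient_extension E Q L L'" if "ordered_labels L e3 e2 e1"
      using that
      by (rule triangle_labels[of L e3 e2 e1 Q c b a E h g f])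
        ((rule trans[OF bdQ], simp add: insert_commute) | (rule trans[OF Q], simp add: insert_commute) |
          (simp add: neq; fail) | simp add: bd insert_commute)+
  qed
qed

text \<open>The renamings permute \<open>a1\<close>, \<open>a2\<close>, \<open>a3\<close> and keep
  \<open>b1\<close> and \<open>b2\<close>.\<close>

lemma good_twins:
  assumes simple: "\<And>e. e \<in> E \<Longrightarrow> card e = 2" and finE: "finite E"
    and Q: "Q = {a1, a2, a3, b1, b2}" and good: "\<And>A. A \<in> Q \<Longrightarrow> good E A"
    and disj: "\<And>A B. A \<in> Q \<Longrightarrow> B \<in> Q \<Longrightarrow> A \<noteq> B \<Longrightarrow> A \<inter> B = {}"
    and bd: "boundary E a1 = {f11, f21, e1}" "boundary E a2 = {f12, f22, e2}"
      "boundary E a3 = {f13, f23, e3}" "boundary E b1 = {f11, f12, f13}" "boundary E b2 = {f21, f22, f23}"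
    and dist: "distinct [a1, a2, a3, b1, b2]" "distinct [f11, f12, f13, f21, f22, f23, e1, e2, e3]"
  shows "good E (\<Union>Q)"
proof -
  have "distinct [e3, e2, e1, f23, f22, f21, f13, f12, f11]" "distinct [b2, b1, a3, a2, a1]"
    using dist distinct_rev[of "[f11, f12, f13, f21, f22, f23, e1, e2, e3]"] distinct_rev[of "[a1, a2, a3, b1, b2]"]
    by (simp_all only: rev.simps append.simps)
  note neq = this[simplified] dist[simplified]
  have bdQ: "boundary E (\<Union>Q) = {e1, e2, e3}"
  proof (rule boundary_UnionI[OF simple disj])
    show "\<Union>(boundary E ` Q) = {f11, f12, f13, f21, f22, f23, e1, e2, e3}" by (auto simp: Q bd)
    show "\<forall>e\<in>{f11, f12, f13, f21, f22, f23, e1, e2, e3}. (\<exists>A\<in>Q. e \<in> boundary E A \<and> (\<forall>B\<in>Q. e \<in> boundary E B \<longrightarrow> B = A)) \<longleftrightarrow>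
        e \<in> {e1, e2, e3}"
      by (simp add: Q bd neq)
  qed auto
  have finQ: "finite Q" by (simp add: Q)
  have dist': "distinct [e1, e2, e3]" using dist(2) by simp
  show ?thesis
  proof (rule good_of_orders[OF simple finE finQ good disj bdQ dist'])
    fix L :: "'a set \<Rightarrow> label"
    show "\<exists>L'. quotient_extension E Q L L'" if "ordered_labels L e1 e2 e3"
      using that
      by (rule twin_labels[of L e1 e2 e3 Q a1 a2 a3 b1 b2 E f11 f21 f12 f22 f13 f23])
        ((rule trans[OF bdQ], simp add: insert_commute) | (rule trans[OF Q], simp add: insert_commute) |
          (simp add: neq; fail) | simp add: bd insert_commute)+
    show "\<exists>L'. quotient_extension E Q L L'" if "ordered_labels L e1 e3 e2"
      using that
      by (rule twin_labels[of L e1 e3 e2 Q a1 a3 a2 b1 b2 E f11 f21 f13 f23 f12 f22])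
        ((rule trans[OF bdQ], simp add: insert_commute) | (rule trans[OF Q], simp add: insert_commute) |
          (simp add: neq; fail) | simp add: bd insert_commute)+
    show "\<exists>L'. quotient_extension E Q L L'" if "ordered_labels L e2 e1 e3"
      using that
      by (rule twin_labels[of L e2 e1 e3 Q a2 a1 a3 b1 b2 E f12 f22 f11 f21 f13 f23])
        ((rule trans[OF bdQ], simp add: insert_commute) | (rule trans[OF Q], simp add: insert_commute) |
          (simp add: neq; fail) | simp add: bd insert_commute)+
    show "\<exists>L'. quotient_extension E Q L L'" if "ordered_labels L e2 e3 e1"
      using that
      by (rule twin_labels[of L e2 e3 e1 Q a2 a3 a1 b1 b2 E f12 f22 f13 f23 f11 f21])
        ((rule trans[OF bdQ], simp add: insert_commute) | (rule trans[OF Q], simp add: insert_commute) |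
          (simp add: neq; fail) | simp add: bd insert_commute)+
    show "\<exists>L'. quotient_extension E Q L L'" if "ordered_labels L e3 e1 e2"
      using that
      by (rule twin_labels[of L e3 e1 e2 Q a3 a1 a2 b1 b2 E f13 f23 f11 f21 f12 f22])
        ((rule trans[OF bdQ], simp add: insert_commute) | (rule trans[OF Q], simp add: insert_commute) |
          (simp add: neq; fail) | simp add: bd insert_commute)+
    show "\<exists>L'. quotient_extension E Q L L'" if "ordered_labels L e3 e2 e1"
      using that
      by (rule twin_labels[of L e3 e2 e1 Q a3 a2 a1 b1 b2 E f13 f23 f12 f22 f11 f21])
        ((rule trans[OF bdQ], simp add: insert_commute) | (rule trans[OF Q], simp add: insert_commute) |
          (simp add: neq; fail) | simp add: bd insert_commute)+
  qed
qed

text \<open>The renamings are the symmetries of the cube that fix \<open>u\<close>: they permute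
  \<open>x\<close>, \<open>y\<close>, \<open>z\<close> together with their antipodes
  \<open>p\<close>, \<open>q\<close>, \<open>r\<close>.\<close>

lemma good_cube:
  assumes simple: "\<And>e. e \<in> E \<Longrightarrow> card e = 2" and finE: "finite E"
    and Q: "Q = {u, x, y, z, p, q, r}" and good: "\<And>A. A \<in> Q \<Longrightarrow> good E A"
    and disj: "\<And>A B. A \<in> Q \<Longrightarrow> B \<in> Q \<Longrightarrow> A \<noteq> B \<Longrightarrow> A \<inter> B = {}"
    and bd: "boundary E u = {ux, uy, uz}"
      "boundary E x = {ux, xq, xr}" "boundary E y = {uy, yp, yr}" "boundary E z = {uz, zp, zq}"
      "boundary E p = {yp, zp, e1}" "boundary E q = {xq, zq, e2}" "boundary E r = {xr, yr, e3}"
    and dist: "distinct [u, x, y, z, p, q, r]" "distinct [ux, uy, uz, xq, xr, yp, yr, zp, zq, e1, e2, e3]"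
  shows "good E (\<Union>Q)"
proof -
  have "distinct [e3, e2, e1, zq, zp, yr, yp, xr, xq, uz, uy, ux]" "distinct [r, q, p, z, y, x, u]"
    using dist distinct_rev[of "[ux, uy, uz, xq, xr, yp, yr, zp, zq, e1, e2, e3]"] distinct_rev[of "[u, x, y, z, p, q, r]"]
    by (simp_all only: rev.simps append.simps)
  note neq = this[simplified] dist[simplified]
  have bdQ: "boundary E (\<Union>Q) = {e1, e2, e3}"
  proof (rule boundary_UnionI[OF simple disj])
    show "\<Union>(boundary E ` Q) = {ux, uy, uz, xq, xr, yp, yr, zp, zq, e1, e2, e3}" by (auto simp: Q bd)
    show "\<forall>e\<in>{ux, uy, uz, xq, xr, yp, yr, zp, zq, e1, e2, e3}. (\<exists>A\<in>Q. e \<in> boundary E A \<and> (\<forall>B\<in>Q. e \<in> boundary E B \<longrightarrow> B = A)) \<longleftrightarrow>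
        e \<in> {e1, e2, e3}"
      by (simp add: Q bd neq)
  qed auto
  have finQ: "finite Q" by (simp add: Q)
  have dist': "distinct [e1, e2, e3]" using dist(2) by simp
  show ?thesis
  proof (rule good_of_orders[OF simple finE finQ good disj bdQ dist'])
    fix L :: "'a set \<Rightarrow> label"
    show "\<exists>L'. quotient_extension E Q L L'" if "ordered_labels L e1 e2 e3"
      using that
      by (rule cube_labels[of L e1 e2 e3 Q u x y z p q r E ux uy uz xq xr yp yr zp zq])
        ((rule trans[OF bdQ], simp add: insert_commute) | (rule trans[OF Q], simp add: insert_commute) |
          (simp add: neq; fail) | simp add: bd insert_commute)+
    show "\<exists>L'. quotient_extension E Q L L'" if "ordered_labels L e1 e3 e2"
      using that
      by (rule cube_labels[of L e1 e3 e2 Q u x z y p r q E ux uz uy xr xq zp zq yp yr])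
        ((rule trans[OF bdQ], simp add: insert_commute) | (rule trans[OF Q], simp add: insert_commute) |
          (simp add: neq; fail) | simp add: bd insert_commute)+
    show "\<exists>L'. quotient_extension E Q L L'" if "ordered_labels L e2 e1 e3"
      using that
      by (rule cube_labels[of L e2 e1 e3 Q u y x z q p r E uy ux uz yp yr xq xr zq zp])
        ((rule trans[OF bdQ], simp add: insert_commute) | (rule trans[OF Q], simp add: insert_commute) |
          (simp add: neq; fail) | simp add: bd insert_commute)+
    show "\<exists>L'. quotient_extension E Q L L'" if "ordered_labels L e2 e3 e1"
      using that
      by (rule cube_labels[of L e2 e3 e1 Q u y z x q r p E uy uz ux yr yp zq zp xq xr])
        ((rule trans[OF bdQ], simp add: insert_commute) | (rule trans[OF Q], simp add: insert_commute) |
          (simp add: neq; fail) | simp add: bd insert_commute)+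
    show "\<exists>L'. quotient_extension E Q L L'" if "ordered_labels L e3 e1 e2"
      using that
      by (rule cube_labels[of L e3 e1 e2 Q u z x y r p q E uz ux uy zp zq xr xq yr yp])
        ((rule trans[OF bdQ], simp add: insert_commute) | (rule trans[OF Q], simp add: insert_commute) |
          (simp add: neq; fail) | simp add: bd insert_commute)+
    show "\<exists>L'. quotient_extension E Q L L'" if "ordered_labels L e3 e2 e1"
      using that
      by (rule cube_labels[of L e3 e2 e1 Q u z y x r q p E uz uy ux zq zp yr yp xr xq])
        ((rule trans[OF bdQ], simp add: insert_commute) | (rule trans[OF Q], simp add: insert_commute) |
          (simp add: neq; fail) | simp add: bd insert_commute)+
  qed
qed

section \<open>Merging parts of a partition\<close>

lemma card_3_distinct: "card {a, b, c} = 3 \<Longrightarrow> a \<noteq> b \<and> a \<noteq> c \<and> b \<noteq> c"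
  by (auto simp: card_insert_if split: if_splits)

text \<open>3-connectedness enters as the bound \<open>three_cut\<close> on edge cuts. It speaks of
  \<open>V\<close> and \<open>E\<close> only, so it survives every merge unchanged.\<close>

locale good_partition =
  fixes V :: "'a set" and E P :: "'a set set"
  assumes simple: "simple_graph V E"
    and three_cut: "\<And>S. S \<subseteq> V \<Longrightarrow> S \<noteq> {} \<Longrightarrow> S \<noteq> V \<Longrightarrow> 3 \<le> card (boundary E S)"
    and union: "\<Union>P = V"
    and good: "\<And>A. A \<in> P \<Longrightarrow> good E A"
    and disj: "\<And>A B. A \<in> P \<Longrightarrow> B \<in> P \<Longrightarrow> A \<noteq> B \<Longrightarrow> A \<inter> B = {}"
begin

lemma card_edge: "e \<in> E \<Longrightarrow> card e = 2"
  using simple unfolding simple_graph_def card_2_iff by metis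

lemma edge_subset: "e \<in> E \<Longrightarrow> e \<subseteq> V"
  using simple unfolding simple_graph_def by fastforce

lemma finite_V: "finite V"
  using simple by (simp add: simple_graph_def)

lemma finite_E: "finite E"
  using edge_subset finite_V by (intro finite_subset[of E "Pow V"]) auto

lemma finite_P: "finite P"
  using finite_V union by (intro finite_subset[of P "Pow V"]) auto

lemma boundary_between:
  assumes "A \<in> P" "B \<in> P" "A \<noteq> B" "e \<in> boundary E A" "e \<in> boundary E B"
  obtains x y where "e = {x, y}" "x \<in> A" "y \<in> B"
proof -
  obtain x y where xy: "x \<in> e" "x \<in> A" "y \<in> e" "y \<in> B"
    using assms(4,5) by (auto simp: boundary_def)
  moreover have "x \<noteq> y" using disj[OF assms(1-3)] xy by auto
  moreover have "card e = 2" using assms(4) card_edge by (auto simp: boundary_def)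
  ultimately have "e = {x, y}" by (auto simp: card_2_iff)
  then show thesis using that xy by blast
qed

lemma boundary_third:
  assumes "A \<in> P" "B \<in> P" "C \<in> P" "A \<noteq> B"
    "e \<in> boundary E A" "e \<in> boundary E B" "e \<in> boundary E C"
  shows "C = A \<or> C = B"
proof -
  obtain x y where xy: "e = {x, y}" "x \<in> A" "y \<in> B"
    using boundary_between[OF assms(1,2,4,5,6)] by blast
  then have "x \<in> C \<or> y \<in> C" using assms(7) by (auto simp: boundary_def)
  then show ?thesis using disj[OF assms(1,3)] disj[OF assms(2,3)] xy by blast
qed

lemma boundary_other:
  assumes "A \<in> P" "e \<in> boundary E A"
  obtains B where "B \<in> P" "B \<noteq> A" "e \<in> boundary E B"
proof -
  obtain y where y: "y \<in> e" "y \<notin> A" using assms by (auto simp: boundary_def)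
  moreover have e: "e \<in> E" using assms by (simp add: boundary_def)
  ultimately obtain B where B: "B \<in> P" "y \<in> B" using edge_subset union by blast
  then have "A \<noteq> B" using y by blast
  then have "A \<inter> B = {}" using disj assms B by metis
  then have "e \<in> boundary E B" using assms y B by (auto simp: boundary_def)
  then show thesis using that B \<open>A \<noteq> B\<close> by blast
qed

text \<open>\<open>ngh\<close> and \<open>link\<close> describe the quotient graph. Its edges are
  represented by edges of \<open>E\<close>, so labels need no translation. The description in
  \<open>link\<close> makes sense for adjacent parts once there are more than two parts, by
  \<open>link_unique\<close>.\<close>

definition ngh :: "'a set \<Rightarrow> 'a set set" where
  "ngh A = {B \<in> P. B \<noteq> A \<and> boundary E A \<inter> boundary E B \<noteq> {}}"

definition link :: "'a set \<Rightarrow> 'a set \<Rightarrow> 'a set" where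
  "link A B = (THE e. e \<in> boundary E A \<inter> boundary E B)"

lemma link_commute: "link A B = link B A"
  by (simp add: link_def Int_commute)

lemma ngh_sym: "A \<in> P \<Longrightarrow> B \<in> ngh A \<Longrightarrow> A \<in> ngh B"
  by (auto simp: ngh_def)

lemma nghD: "B \<in> ngh A \<Longrightarrow> B \<in> P \<and> B \<noteq> A"
  by (simp add: ngh_def)

lemma part_finite_boundary: "A \<in> P \<Longrightarrow> finite (boundary E A) \<and> card (boundary E A) = 3"
  using good finite_E by (simp add: good_def boundary_def)

lemma good_Union_neq_V: "good E X \<Longrightarrow> X \<noteq> V"
proof
  assume "good E X" "X = V"
  then have "boundary E X = {}" using edge_subset by (auto simp: boundary_def)
  then show False using \<open>good E X\<close> by (simp add: good_def)
qed

context
  assumes large: "2 < card P"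
begin

text \<open>With two edges between them, \<open>A\<close> and \<open>B\<close> have at most one
  further boundary edge each, so their union has at most two. By \<open>three_cut\<close> the union
  is \<open>V\<close>, which leaves no room for a third part.\<close>

lemma link_unique:
  assumes AB: "A \<in> P" "B \<in> P" "A \<noteq> B" and e: "e \<in> boundary E A" "e \<in> boundary E B"
    and f: "f \<in> boundary E A" "f \<in> boundary E B"
  shows "e = f"
proof (rule ccontr)
  assume ef: "e \<noteq> f"
  have inside: "g \<subseteq> A \<union> B" if "g \<in> boundary E A" "g \<in> boundary E B" for g
    using boundary_between[OF AB that] by blast
  have "boundary E (A \<union> B) \<subseteq> (boundary E A - {e, f}) \<union> (boundary E B - {e, f})"
  proof
    fix g assume g: "g \<in> boundary E (A \<union> B)"
    then have "g \<noteq> e" "g \<noteq> f" using inside[OF e] inside[OF f] by (auto simp: boundary_def)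
    moreover have "g \<in> boundary E A \<or> g \<in> boundary E B" using g by (auto simp: boundary_def)
    ultimately show "g \<in> (boundary E A - {e, f}) \<union> (boundary E B - {e, f})" by blast
  qed
  then have "card (boundary E (A \<union> B)) \<le> card ((boundary E A - {e, f}) \<union> (boundary E B - {e, f}))"
    using part_finite_boundary AB by (intro card_mono) auto
  also have "\<dots> \<le> card (boundary E A - {e, f}) + card (boundary E B - {e, f})"
    by (rule card_Un_le)
  also have "\<dots> = 2"
    using part_finite_boundary[OF AB(1)] part_finite_boundary[OF AB(2)] e f ef
    by (simp add: card_Diff_subset)
  finally have "\<not> 3 \<le> card (boundary E (A \<union> B))" by simp
  moreover have "A \<union> B \<subseteq> V" using AB union by blast
  moreover have "A \<union> B \<noteq> {}" using good_nonempty[OF good[OF AB(1)]] by blast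
  ultimately have V: "A \<union> B = V" using three_cut by blast
  have "C \<in> {A, B}" if C: "C \<in> P" for C
  proof -
    obtain v where v: "v \<in> C" using good_nonempty[OF good[OF C]] by blast
    then have "v \<in> A \<or> v \<in> B" using V C union by blast
    then show ?thesis using disj[OF C AB(1)] disj[OF C AB(2)] v by blast
  qed
  then have "card P \<le> card {A, B}" by (intro card_mono) auto
  then show False using large AB by simp
qed

lemma link_eqI:
  assumes "A \<in> P" "B \<in> P" "A \<noteq> B" "e \<in> boundary E A" "e \<in> boundary E B"
  shows "link A B = e"
  unfolding link_def using link_unique[OF assms(1-3)] assms(4,5) by (intro the_equality) auto

lemma link_in:
  assumes "A \<in> P" "B \<in> ngh A"
  shows "link A B \<in> boundary E A" "link A B \<in> boundary E B"
proof -
  obtain e where "e \<in> boundary E A" "e \<in> boundary E B" "B \<in> P" "A \<noteq> B"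
    using assms by (auto simp: ngh_def)
  then show "link A B \<in> boundary E A" "link A B \<in> boundary E B"
    using link_eqI[of A B e] assms by simp_all
qed

text \<open>An edge has two ends and so touches at most two parts. Used as a rewrite rule, this
  reduces distinctness of edges to distinctness of parts.\<close>

lemma link_eq_iff:
  assumes "A \<in> P" "B \<in> ngh A" "C \<in> P" "D \<in> ngh C"
  shows "link A B = link C D \<longleftrightarrow> A = C \<and> B = D \<or> A = D \<and> B = C"
proof
  assume eq: "link A B = link C D"
  have B: "B \<in> P" "A \<noteq> B" and D: "D \<in> P" using nghD assms by blast+
  have CD: "link A B \<in> boundary E C" "link A B \<in> boundary E D"
    unfolding eq by (rule link_in[OF assms(3,4)])+
  have "C = A \<or> C = B"
    using assms(1) B(1) assms(3) B(2) link_in[OF assms(1,2)] CD(1) by (rule boundary_third)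
  moreover have "D = A \<or> D = B"
    using assms(1) B(1) D B(2) link_in[OF assms(1,2)] CD(2) by (rule boundary_third)
  ultimately show "A = C \<and> B = D \<or> A = D \<and> B = C" using nghD[OF assms(4)] by auto
qed (auto simp: link_commute)

lemma boundary_eq_links:
  assumes "A \<in> P"
  shows "boundary E A = link A ` ngh A"
proof (intro equalityI subsetI)
  fix e assume e: "e \<in> boundary E A"
  then obtain B where B: "B \<in> P" "B \<noteq> A" "e \<in> boundary E B"
    using boundary_other[OF assms] by blast
  then have "B \<in> ngh A" "link A B = e" using e assms link_eqI[of A B e] by (auto simp: ngh_def)
  then show "e \<in> link A ` ngh A" by blast
qed (use link_in[OF assms] in auto)

lemma card_ngh:
  assumes "A \<in> P"
  shows "card (ngh A) = 3"
proof -
  have "inj_on (link A) (ngh A)"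
  proof (rule inj_onI)
    fix B C assume "B \<in> ngh A" "C \<in> ngh A" "link A B = link A C"
    then show "B = C" using link_eq_iff[OF assms _ assms] by metis
  qed
  then have "card (boundary E A) = card (ngh A)"
    unfolding boundary_eq_links[OF assms] by (rule card_image)
  then show ?thesis using part_finite_boundary[OF assms] by simp
qed

lemma third_neighbour:
  assumes "A \<in> P" "B \<in> ngh A" "C \<in> ngh A" "B \<noteq> C"
  obtains D where "ngh A = {B, C, D}" "D \<in> P" "D \<noteq> A" "D \<noteq> B" "D \<noteq> C"
proof -
  have "card (ngh A - {B, C}) = 1"
    using card_ngh[OF assms(1)] assms by (simp add: card_Diff_subset)
  then obtain D where D: "ngh A - {B, C} = {D}" by (rule card_1_singletonE)
  then have "D \<in> ngh A - {B, C}" by simp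
  then have "D \<in> ngh A" "D \<noteq> B" "D \<noteq> C" by simp_all
  moreover have "ngh A = {B, C} \<union> (ngh A - {B, C})" using assms(2,3) by auto
  then have "ngh A = {B, C, D}" unfolding D by auto
  ultimately show thesis using that nghD by metis
qed

text \<open>The outer neighbours \<open>x\<close>, \<open>y\<close>, \<open>z\<close> may coincide;
  the three outgoing edges differ anyway, since they start at different parts and leave the
  triangle.\<close>

lemma merge_triangle:
  assumes a: "a \<in> P" "b \<in> ngh a" "c \<in> ngh a" "c \<in> ngh b"
  shows "good E (\<Union>{a, b, c})"
proof -
  have P: "b \<in> P" "c \<in> P" and neq: "a \<noteq> b" "a \<noteq> c" "b \<noteq> c" using nghD a by blast+
  have N: "a \<in> ngh b" "a \<in> ngh c" "b \<in> ngh c" using ngh_sym a P by blast+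
  obtain x where x: "ngh a = {b, c, x}" "x \<in> P" "x \<noteq> a" "x \<noteq> b" "x \<noteq> c"
    using third_neighbour[of a b c] a P neq by blast
  obtain y where y: "ngh b = {a, c, y}" "y \<in> P" "y \<noteq> b" "y \<noteq> a" "y \<noteq> c"
    using third_neighbour[of b a c] a P N neq by blast
  obtain z where z: "ngh c = {a, b, z}" "z \<in> P" "z \<noteq> c" "z \<noteq> a" "z \<noteq> b"
    using third_neighbour[of c a b] a P N neq by blast
  show ?thesis
  proof (rule good_triangle[of E "{a, b, c}" a b c "link a b" "link a c" "link a x" "link b c"
        "link b y" "link c z"])
    show "boundary E a = {link a b, link a c, link a x}"
      using a by (simp add: boundary_eq_links x)
    show "boundary E b = {link a b, link b c, link b y}"
      using P by (simp add: boundary_eq_links y link_commute[of b a])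
    show "boundary E c = {link a c, link b c, link c z}"
      using P by (simp add: boundary_eq_links z link_commute[of c a] link_commute[of c b])
    show "distinct [link a b, link a c, link b c, link a x, link b y, link c z]"
      using neq x(2-5) y(2-5) z(2-5) by (simp add: link_eq_iff a(1) P x(1) y(1) z(1))
    show "\<And>A. A \<in> {a, b, c} \<Longrightarrow> good E A" using good a P by auto
    show "\<And>A B. A \<in> {a, b, c} \<Longrightarrow> B \<in> {a, b, c} \<Longrightarrow> A \<noteq> B \<Longrightarrow> A \<inter> B = {}"
      by (rule disj) (use a P in auto)
  qed (use neq card_edge finite_E in auto)
qed

context
  assumes triangle_free: "\<And>a b c. a \<in> P \<Longrightarrow> b \<in> ngh a \<Longrightarrow> c \<in> ngh a \<Longrightarrow> c \<notin> ngh b"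
begin

text \<open>The third edge at \<open>a1\<close> must not lead to \<open>a2\<close> or
  \<open>a3\<close>, as it would then be an inner edge; but such an edge would close a triangle with
  \<open>b1\<close>. Likewise for \<open>a2\<close> and \<open>a3\<close>.\<close>

lemma merge_twins:
  assumes b: "b1 \<in> P" "b2 \<in> P" "b1 \<noteq> b2" and N: "ngh b1 = {a1, a2, a3}" "ngh b2 = {a1, a2, a3}"
    and neq: "a1 \<noteq> a2" "a1 \<noteq> a3" "a2 \<noteq> a3"
  shows "good E (\<Union>{a1, a2, a3, b1, b2})"
proof -
  have aN: "a1 \<in> ngh b1" "a2 \<in> ngh b1" "a3 \<in> ngh b1" "a1 \<in> ngh b2" "a2 \<in> ngh b2" "a3 \<in> ngh b2"
    by (simp_all add: N)
  have P: "a1 \<in> P" "a2 \<in> P" "a3 \<in> P" and ab: "a1 \<noteq> b1" "a2 \<noteq> b1" "a3 \<noteq> b1" "a1 \<noteq> b2" "a2 \<noteq> b2" "a3 \<noteq> b2"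
    using nghD aN by blast+
  have third: "\<exists>y. ngh a = {b1, b2, y} \<and> y \<in> P \<and> y \<noteq> a \<and> y \<noteq> b1 \<and> y \<noteq> b2 \<and> y \<notin> {a1, a2, a3}"
    if a: "a \<in> {a1, a2, a3}" for a
  proof -
    have a1: "a \<in> ngh b1" "a \<in> ngh b2" using a by (simp_all only: N)
    then have aP: "a \<in> P" using nghD by blast
    have "b1 \<in> ngh a" "b2 \<in> ngh a" using ngh_sym a1 b by blast+
    then obtain y where y: "ngh a = {b1, b2, y}" "y \<in> P" "y \<noteq> a" "y \<noteq> b1" "y \<noteq> b2"
      using third_neighbour[of a b1 b2] aP b by blast
    have "y \<notin> ngh b1" using triangle_free[OF b(1) a1(1), of y] y(1) by auto
    then show ?thesis using y by (simp only: N) blast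
  qed
  obtain y1 where y1: "ngh a1 = {b1, b2, y1}" "y1 \<in> P" "y1 \<noteq> b1" "y1 \<noteq> b2" "y1 \<notin> {a1, a2, a3}"
    using third[of a1] by auto
  obtain y2 where y2: "ngh a2 = {b1, b2, y2}" "y2 \<in> P" "y2 \<noteq> b1" "y2 \<noteq> b2" "y2 \<notin> {a1, a2, a3}"
    using third[of a2] by auto
  obtain y3 where y3: "ngh a3 = {b1, b2, y3}" "y3 \<in> P" "y3 \<noteq> b1" "y3 \<noteq> b2" "y3 \<notin> {a1, a2, a3}"
    using third[of a3] by auto
  show ?thesis
  proof (rule good_twins[where Q = "{a1, a2, a3, b1, b2}" and ?a1.0 = a1 and ?a2.0 = a2 and ?a3.0 = a3
        and ?b1.0 = b1 and ?b2.0 = b2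
        and ?f11.0 = "link b1 a1" and ?f12.0 = "link b1 a2" and ?f13.0 = "link b1 a3"
        and ?f21.0 = "link b2 a1" and ?f22.0 = "link b2 a2" and ?f23.0 = "link b2 a3"
        and ?e1.0 = "link a1 y1" and ?e2.0 = "link a2 y2" and ?e3.0 = "link a3 y3"])
    show "boundary E a1 = {link b1 a1, link b2 a1, link a1 y1}"
      using P by (simp add: boundary_eq_links y1(1) link_commute[of a1 b1] link_commute[of a1 b2])
    show "boundary E a2 = {link b1 a2, link b2 a2, link a2 y2}"
      using P by (simp add: boundary_eq_links y2(1) link_commute[of a2 b1] link_commute[of a2 b2])
    show "boundary E a3 = {link b1 a3, link b2 a3, link a3 y3}"
      using P by (simp add: boundary_eq_links y3(1) link_commute[of a3 b1] link_commute[of a3 b2])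
    show "boundary E b1 = {link b1 a1, link b1 a2, link b1 a3}"
      "boundary E b2 = {link b2 a1, link b2 a2, link b2 a3}"
      using b by (simp_all add: boundary_eq_links N)
    show "distinct [link b1 a1, link b1 a2, link b1 a3, link b2 a1, link b2 a2, link b2 a3,
        link a1 y1, link a2 y2, link a3 y3]"
      using neq b(3) ab y1(2-5) y2(2-5) y3(2-5)
      by (simp add: link_eq_iff b(1,2) P y1(1) y2(1) y3(1) N)
    show "\<And>A. A \<in> {a1, a2, a3, b1, b2} \<Longrightarrow> good E A" using good b P by auto
    show "\<And>A B. A \<in> {a1, a2, a3, b1, b2} \<Longrightarrow> B \<in> {a1, a2, a3, b1, b2} \<Longrightarrow> A \<noteq> B \<Longrightarrow> A \<inter> B = {}"
      by (rule disj) (use b P in auto)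
  qed (use neq b ab card_edge finite_E in auto)
qed

text \<open>The neighbourhoods alone do not exclude coincidences. Triangle-freeness yields that the
  seven parts are distinct and that \<open>p\<close>, \<open>q\<close>, \<open>r\<close> are
  pairwise non-adjacent, so their third edges lead out. The outer ends \<open>p'\<close>,
  \<open>q'\<close>, \<open>r'\<close> may still coincide, as in the full cube.\<close>

lemma merge_cube:
  assumes u: "u \<in> P" and N: "ngh u = {x, y, z}" "ngh x = {u, q, r}" "ngh y = {u, p, r}" "ngh z = {u, p, q}"
  shows "good E (\<Union>{u, x, y, z, p, q, r})"
proof -
  have mem: "x \<in> ngh u" "y \<in> ngh u" "z \<in> ngh u" "q \<in> ngh x" "r \<in> ngh x"
    "p \<in> ngh y" "r \<in> ngh y" "p \<in> ngh z" "q \<in> ngh z" by (simp_all add: N)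
  have P1: "x \<in> P" "y \<in> P" "z \<in> P" and P: "p \<in> P" "q \<in> P" "r \<in> P"
    and neq2: "x \<noteq> u" "y \<noteq> u" "z \<noteq> u" "q \<noteq> x" "r \<noteq> x" "p \<noteq> y" "r \<noteq> y" "p \<noteq> z" "q \<noteq> z"
    using mem[THEN nghD] by simp_all
  have "card {x, y, z} = 3" "card {u, q, r} = 3" "card {u, p, r} = 3" "card {u, p, q} = 3"
    using card_ngh[OF u] card_ngh[OF P1(1)] card_ngh[OF P1(2)] card_ngh[OF P1(3)] by (simp_all only: N)
  note card3 = this[THEN card_3_distinct]
  then have neq: "x \<noteq> y" "x \<noteq> z" "y \<noteq> z" "u \<noteq> p" "u \<noteq> q" "u \<noteq> r" "p \<noteq> q" "p \<noteq> r" "q \<noteq> r"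
    by simp_all
  have "x \<notin> ngh y" "y \<notin> ngh x" "z \<notin> ngh x"
    using triangle_free[OF u mem(2,1)] triangle_free[OF u mem(1,2)] triangle_free[OF u mem(1,3)] .
  then have neq3: "x \<noteq> p" "y \<noteq> q" "z \<noteq> r" using mem by metis+
  have memb: "x \<in> ngh q" "x \<in> ngh r" "y \<in> ngh p" "y \<in> ngh r" "z \<in> ngh p" "z \<in> ngh q"
    by (rule ngh_sym; simp add: P P1 mem)+
  obtain p' where p': "ngh p = {y, z, p'}" "p' \<in> P" "p' \<noteq> p" "p' \<noteq> y" "p' \<noteq> z"
    using third_neighbour[OF P(1) memb(3,5) neq(3)] .
  obtain q' where q': "ngh q = {x, z, q'}" "q' \<in> P" "q' \<noteq> q" "q' \<noteq> x" "q' \<noteq> z"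
    using third_neighbour[OF P(2) memb(1,6) neq(2)] .
  obtain r' where r': "ngh r = {x, y, r'}" "r' \<in> P" "r' \<noteq> r" "r' \<noteq> x" "r' \<noteq> y"
    using third_neighbour[OF P(3) memb(2,4) neq(1)] .
  have "p \<notin> ngh u" "q \<notin> ngh u" "r \<notin> ngh u" using neq2 neq3 by (simp_all add: N not_sym)
  then have not_u: "u \<notin> ngh p" "u \<notin> ngh q" "u \<notin> ngh r" using ngh_sym P by blast+
  have "p \<notin> ngh x" "q \<notin> ngh y" "r \<notin> ngh z" using neq by (simp_all add: N not_sym)
  then have not_leaf: "x \<notin> ngh p" "y \<notin> ngh q" "z \<notin> ngh r" using ngh_sym P by blast+
  have "q \<notin> ngh p" "p \<notin> ngh q" "r \<notin> ngh p" "p \<notin> ngh r" "r \<notin> ngh q" "q \<notin> ngh r"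
    using triangle_free[OF P1(3) mem(8,9)] triangle_free[OF P1(3) mem(9,8)]
      triangle_free[OF P1(2) mem(6,7)] triangle_free[OF P1(2) mem(7,6)]
      triangle_free[OF P1(1) mem(4,5)] triangle_free[OF P1(1) mem(5,4)] .
  moreover have "p' \<in> ngh p" "q' \<in> ngh q" "r' \<in> ngh r" by (simp_all add: p'(1) q'(1) r'(1))
  ultimately have p2: "p' \<noteq> u" "p' \<noteq> x" "p' \<noteq> q" "p' \<noteq> r"
    and q2: "q' \<noteq> u" "q' \<noteq> y" "q' \<noteq> p" "q' \<noteq> r"
    and r2: "r' \<noteq> u" "r' \<noteq> z" "r' \<noteq> p" "r' \<noteq> q"
    using not_u not_leaf by metis+
  show ?thesis
  proof (rule good_cube[where Q = "{u, x, y, z, p, q, r}" and u = u and x = x and y = y and z = z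
        and p = p and q = q and r = r and ux = "link u x" and uy = "link u y" and uz = "link u z"
        and xq = "link x q" and xr = "link x r" and yp = "link y p" and yr = "link y r"
        and zp = "link z p" and zq = "link z q"
        and ?e1.0 = "link p p'" and ?e2.0 = "link q q'" and ?e3.0 = "link r r'"])
    show "boundary E u = {link u x, link u y, link u z}"
      using u by (simp add: boundary_eq_links N)
    show "boundary E x = {link u x, link x q, link x r}"
      "boundary E y = {link u y, link y p, link y r}"
      "boundary E z = {link u z, link z p, link z q}"
      using P1 by (simp_all add: boundary_eq_links N link_commute[of _ u])
    show "boundary E p = {link y p, link z p, link p p'}"
      using P by (simp add: boundary_eq_links p'(1) link_commute[of p y] link_commute[of p z])
    show "boundary E q = {link x q, link z q, link q q'}"
      using P by (simp add: boundary_eq_links q'(1) link_commute[of q x] link_commute[of q z])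
    show "boundary E r = {link x r, link y r, link r r'}"
      using P by (simp add: boundary_eq_links r'(1) link_commute[of r x] link_commute[of r y])
    show "distinct [link u x, link u y, link u z, link x q, link x r, link y p, link y r, link z p,
        link z q, link p p', link q q', link r r']"
      using neq neq2 neq3 p'(2-5) q'(2-5) r'(2-5) p2 q2 r2
      by (simp add: link_eq_iff u P P1 p'(1) q'(1) r'(1) N)
    show "\<And>A. A \<in> {u, x, y, z, p, q, r} \<Longrightarrow> good E A" using good u P P1 by auto
    show "\<And>A B. A \<in> {u, x, y, z, p, q, r} \<Longrightarrow> B \<in> {u, x, y, z, p, q, r} \<Longrightarrow> A \<noteq> B \<Longrightarrow> A \<inter> B = {}"
      by (rule disj) (use u P P1 in auto)
    show "distinct [u, x, y, z, p, q, r]" using neq neq2 neq3 by auto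
  qed (use card_edge finite_E in auto)
qed

end

end

end

text \<open>Contracting connected parts does not raise the tree-width: replacing each bag by the
  parts that it meets gives a tree decomposition of the quotient, to which
  \<open>cubic_width3_config\<close> applies if there is no triangle.\<close>

lemma (in good_partition) exists_merge:
  assumes large: "2 < card P" and td: "tree_decomposition V E I F B"
    and width: "\<And>i. i \<in> I \<Longrightarrow> card (B i) \<le> 4"
  shows "\<exists>Q\<subseteq>P. 2 \<le> card Q \<and> good E (\<Union>Q)"
proof (cases "\<exists>a b c. a \<in> P \<and> b \<in> ngh a \<and> c \<in> ngh a \<and> c \<in> ngh b")
  case True
  then obtain a b c where abc: "a \<in> P" "b \<in> ngh a" "c \<in> ngh a" "c \<in> ngh b" by (elim exE conjE)
  have "b \<in> P" "c \<in> P" "a \<noteq> b" using nghD abc by blast+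
  moreover from this have "card {a, b} \<le> card {a, b, c}" by (intro card_mono) auto
  ultimately show ?thesis
    using merge_triangle[OF large abc] abc(1) by (intro exI[of _ "{a, b, c}"]) simp
next
  case False
  then have triangle_free: "\<And>a b c. a \<in> P \<Longrightarrow> b \<in> ngh a \<Longrightarrow> c \<in> ngh a \<Longrightarrow> c \<notin> ngh b" by simp
  have tree: "is_tree I F" and BV: "\<And>i. i \<in> I \<Longrightarrow> B i \<subseteq> V"
    and vertex: "\<And>v. v \<in> V \<Longrightarrow> \<exists>i\<in>I. v \<in> B i"
    and edge: "\<And>e. e \<in> E \<Longrightarrow> \<exists>i\<in>I. e \<subseteq> B i"
    and subtree: "\<And>v. v \<in> V \<Longrightarrow> connected_on {i \<in> I. v \<in> B i} F"
    using td unfolding tree_decomposition_def by simp_all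
  define D where "D i = {A \<in> P. A \<inter> B i \<noteq> {}}" for i
  have conn: "connected_on {i \<in> I. A \<in> D i} F" if A: "A \<in> P" for A
  proof -
    have J: "{i \<in> I. A \<in> D i} = {i \<in> I. A \<inter> B i \<noteq> {}}" using A by (simp add: D_def)
    have AV: "A \<subseteq> V" using A union by blast
    have sub: "reachable {i \<in> I. A \<inter> B i \<noteq> {}} F i j"
      if "v \<in> A" "i \<in> I" "v \<in> B i" "j \<in> I" "v \<in> B j" for v i j
    proof -
      have "reachable {i \<in> I. v \<in> B i} F i j"
        using subtree[of v] that AV by (auto simp: connected_on_def)
      then show ?thesis by (rule reachable_mono) (use that in auto)
    qed
    obtain v where v: "v \<in> A" using good_nonempty[OF good[OF A]] by blast
    then obtain i where i: "i \<in> I" "v \<in> B i" using vertex AV by blast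
    \<comment> \<open>Along a walk inside \<open>A\<close>, consecutive vertices share a bag
      containing their edge, so the subtrees of the vertices of \<open>A\<close> join up to a single
      one.\<close>
    have walk: "\<forall>j\<in>I. w \<in> B j \<longrightarrow> reachable {i \<in> I. A \<inter> B i \<noteq> {}} F i j"
      if "reachable A E v w" for w
      using that
    proof (induction rule: reachable_induct)
      case refl
      show ?case using sub[OF v i] by simp
    next
      case (step y z)
      obtain k where k: "k \<in> I" "{y, z} \<subseteq> B k" using edge[OF step.hyps(4)] by blast
      then have "reachable {i \<in> I. A \<inter> B i \<noteq> {}} F i k" using step.IH by simp
      moreover have "reachable {i \<in> I. A \<inter> B i \<noteq> {}} F k j" if "j \<in> I" "z \<in> B j" for j
        using sub[OF step.hyps(3)] k that by simp
      ultimately show ?case by (intro ballI impI) (rule reachable_trans)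
    qed
    have reach: "reachable {i \<in> I. A \<inter> B i \<noteq> {}} F i j"
      if j: "j \<in> {i \<in> I. A \<inter> B i \<noteq> {}}" for j
    proof -
      from j obtain w where w: "w \<in> A" "w \<in> B j" by blast
      have "reachable A E v w"
        using good_connected[OF good[OF A]] v w(1) by (simp add: connected_on_def)
      from walk[OF this] show ?thesis using w j by simp
    qed
    show ?thesis
      unfolding J by (rule connected_onI[of i]) (use reach v i in auto)
  qed
  have width': "D i \<subseteq> P \<and> finite (D i) \<and> card (D i) \<le> 4" if i: "i \<in> I" for i
  proof (intro conjI)
    show DP: "D i \<subseteq> P" by (auto simp: D_def)
    then show "finite (D i)" using finite_P finite_subset by blast
    have "\<forall>A\<in>D i. \<exists>v. v \<in> A \<inter> B i" by (auto simp: D_def)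
    \<comment> \<open>Pick a vertex of the bag from each part that it meets; the parts are disjoint,
      so there are at most as many of them as vertices in the bag.\<close>
    then obtain f where f: "\<And>A. A \<in> D i \<Longrightarrow> f A \<in> A \<inter> B i" by metis
    have "inj_on f (D i)"
    proof (rule inj_onI, rule ccontr)
      fix A C assume AC: "A \<in> D i" "C \<in> D i" "f A = f C" "A \<noteq> C"
      then have "A \<inter> C = {}" using disj DP by blast
      then show False using f[OF AC(1)] f[OF AC(2)] AC(3) by auto
    qed
    moreover have "f ` D i \<subseteq> B i" using f by auto
    moreover have "finite (B i)" using BV[OF i] finite_V finite_subset by blast
    ultimately have "card (D i) \<le> card (B i)" by (rule card_inj_on_le)
    then show "card (D i) \<le> 4" using width[OF i] by simp
  qed
  have cover: "\<exists>i\<in>I. A \<in> D i \<and> C \<in> D i" if AC: "A \<in> P" "C \<in> ngh A" for A C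
  proof -
    obtain e where e: "e \<in> boundary E A" "e \<in> boundary E C" "C \<in> P"
      using AC by (auto simp: ngh_def)
    then obtain i where "i \<in> I" "e \<subseteq> B i" using edge by (auto simp: boundary_def)
    then show ?thesis using e AC by (intro bexI[of _ i]) (auto simp: D_def boundary_def)
  qed
  have "P \<noteq> {}" using large by auto
  have N: "ngh A \<subseteq> P \<and> card (ngh A) = 3 \<and> A \<notin> ngh A" if "A \<in> P" for A
    using card_ngh[OF large that] nghD by blast
  have "(\<exists>a\<in>P. \<exists>b\<in>P. a \<noteq> b \<and> ngh a = ngh b) \<or>
    (\<exists>u x y z p q r. u \<in> P \<and> ngh u = {x, y, z} \<and> ngh x = {u, q, r} \<and> ngh y = {u, p, r} \<and>
      ngh z = {u, p, q})"
    by (rule cubic_width3_config[OF tree \<open>P \<noteq> {}\<close> conn width' N ngh_sym cover triangle_free])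
  then consider (twins) a b where "a \<in> P" "b \<in> P" "a \<noteq> b" "ngh a = ngh b"
    | (cube) u x y z p q r where "u \<in> P" "ngh u = {x, y, z}" "ngh x = {u, q, r}" "ngh y = {u, p, r}"
      "ngh z = {u, p, q}"
    by (elim disjE bexE exE conjE)
  then show ?thesis
  proof cases
    case twins
    obtain a1 a2 a3 where N: "ngh a = {a1, a2, a3}" "a1 \<noteq> a2" "a2 \<noteq> a3" "a1 \<noteq> a3"
      using card_ngh[OF large twins(1)] by (metis card_3_iff)
    then have "a1 \<in> P" "a2 \<in> P" "a3 \<in> P" using nghD[of _ a] by simp_all
    moreover have "good E (\<Union>{a1, a2, a3, a, b})"
      by (rule merge_twins[OF large triangle_free twins(1-3)]) (use N twins(4) in simp_all)
    moreover have "card {a1, a2} \<le> card {a1, a2, a3, a, b}" by (intro card_mono) auto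
    ultimately show ?thesis
      using N(2) twins(1,2) by (intro exI[of _ "{a1, a2, a3, a, b}"]) simp
  next
    case cube
    have P: "x \<in> P" "y \<in> P" "z \<in> P" "x \<noteq> u" using nghD[of _ u] by (simp_all add: cube)
    moreover have "p \<in> P" "q \<in> P" "r \<in> P" using nghD[of _ y] nghD[of _ z] by (simp_all add: cube)
    moreover have "good E (\<Union>{u, x, y, z, p, q, r})"
      by (rule merge_cube[OF large triangle_free cube])
    moreover have "card {u, x} \<le> card {u, x, y, z, p, q, r}" by (intro card_mono) auto
    ultimately show ?thesis
      using cube(1) by (intro exI[of _ "{u, x, y, z, p, q, r}"]) simp
  qed
qed

text \<open>Both parts have the same three boundary edges. One tree edge joins the two inner trees,
  and making the other two cycle edges is admissible on both sides.\<close>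

lemma (in good_partition) two_parts:
  assumes "card P = 2"
  shows "\<exists>L. extension E L0 V L"
proof -
  obtain A B where AB: "P = {A, B}" "A \<noteq> B" using assms by (auto simp: card_2_iff)
  have V: "V = A \<union> B" using union AB by auto
  have "boundary E A = boundary E B"
    using disj[of A B] AB edge_subset V unfolding boundary_def by fastforce
  moreover obtain a b c where abc: "boundary E A = {a, b, c}" "a \<noteq> b" "a \<noteq> c" "b \<noteq> c"
    using good[of A] AB unfolding good_def by (metis card_3_iff insertI1)
  ultimately have bdB: "boundary E B = {a, b, c}" by simp
  \<comment> \<open>Nothing leaves \<open>V\<close>, so \<open>L0\<close> imposes no condition and
    may be arbitrary.\<close>
  have bdV: "boundary E (\<Union>P) = {}" using edge_subset union by (auto simp: boundary_def)
  let ?L = "(\<lambda>_. Cycle)(a := Tree)"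
  have "\<exists>L'. quotient_extension E P L0 L'"
  proof (rule quotient_extensionI[where L' = ?L and r = A and es = "[a]"], unfold bdV)
    show "\<forall>D\<in>P. valid ?L (boundary E D)"
      using abc(2-4) by (simp add: AB bdB abc(1) valid_triple ordered_labels_def)
    show "{e \<in> (\<Union>A\<in>P. boundary E A) - {}. ?L e = Tree} \<subseteq> set [a]" by (auto split: if_splits)
    show "\<forall>S. A \<in> S \<longrightarrow> (\<forall>A\<in>P. \<forall>B\<in>P. A \<in> S \<longrightarrow>
        (\<exists>e\<in>boundary E A. e \<in> boundary E B \<and> ?L e = Tree) \<longrightarrow> B \<in> S) \<longrightarrow> P \<subseteq> S"
      using AB(2) by (simp add: AB(1) bdB abc(1))
  qed (use AB in simp_all)
  then obtain L' where L': "quotient_extension E P L0 L'" by (elim exE)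
  show ?thesis
    using quotient_extension_glue[OF card_edge finite_E finite_P good disj L'] union by simp
qed

lemma good_partition_extension:
  assumes "good_partition V E P" and "2 \<le> card P" and td: "tree_decomposition V E I F B"
    and width: "\<And>i. i \<in> I \<Longrightarrow> card (B i) \<le> 4"
  shows "\<exists>L. extension E L0 V L"
  using assms(1,2)
proof (induction "card P" arbitrary: P rule: less_induct)
  case less
  interpret good_partition V E P by (rule less.prems)
  show ?case
  proof (cases "card P = 2")
    case True
    then show ?thesis by (rule two_parts)
  next
    case False
    then have "2 < card P" using less.prems by simp
    then obtain Q where Q: "Q \<subseteq> P" "2 \<le> card Q" "good E (\<Union>Q)"
      using exists_merge[OF _ td width] by blast
    define P' where "P' = insert (\<Union>Q) (P - Q)"
    have finQ: "finite Q" using Q finite_P finite_subset by blast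
    have disjQ: "\<Union>Q \<inter> A = {}" if "A \<in> P - Q" for A using that Q disj by blast
    have notin: "\<Union>Q \<notin> P - Q" using disjQ good_nonempty[OF Q(3)] by blast
    \<comment> \<open>The parts in \<open>Q\<close> are replaced by one, a real decrease as
      \<open>Q\<close> has at least two.\<close>
    have "card P' = Suc (card P - card Q)"
      unfolding P'_def using notin finite_P finQ Q(1) by (simp add: card_Diff_subset)
    then have small: "card P' < card P" using Q(2) card_mono[OF finite_P Q(1)] by linarith
    \<comment> \<open>A good set has three boundary edges while \<open>V\<close> has none. So a part
      outside \<open>Q\<close> remains, and the merge leaves at least two parts.\<close>
    have "Q \<noteq> P" using good_Union_neq_V[OF Q(3)] union by auto
    then have "card Q < card P" using Q(1) finite_P by (metis psubsetI psubset_card_mono)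
    then have two: "2 \<le> card P'" using \<open>card P' = Suc (card P - card Q)\<close> by linarith
    have "good_partition V E P'"
    proof
      show "\<Union>P' = V" using union Q(1) by (auto simp: P'_def)
      show "good E A" if "A \<in> P'" for A using that Q(3) good by (auto simp: P'_def)
      show "A \<inter> C = {}" if AC: "A \<in> P'" "C \<in> P'" "A \<noteq> C" for A C
      proof -
        consider "A = \<Union>Q" "C \<in> P - Q" | "C = \<Union>Q" "A \<in> P - Q" | "A \<in> P" "C \<in> P"
          using AC by (auto simp: P'_def)
        then show ?thesis
        proof cases
          case 2
          then show ?thesis using disjQ[of A] by (simp add: Int_commute)
        qed (use disjQ disj AC in auto)
      qed
    qed (fact simple three_cut)+
    then show ?thesis using less.hyps[OF small] two by blast
  qed
qed

section \<open>Edge cuts, tree decompositions and vertex degrees of the given graph\<close>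

lemma boundary_singleton:
  assumes "simple_graph V E"
  shows "boundary E {v} = {e \<in> E. v \<in> e}"
proof -
  have "\<not> e \<subseteq> {v}" if "e \<in> E" for e
    using assms that unfolding simple_graph_def by fastforce
  then show ?thesis by (auto simp: boundary_def)
qed

text \<open>Choose the end in \<open>S\<close> of each edge of a cut with at most two edges.
  Deleting these at most two vertices would separate the rest of \<open>S\<close> from the outside,
  so there is no rest. Then \<open>S\<close> has one or two vertices, and 3-regularity makes its
  boundary too large.\<close>

lemma three_connected_cut:
  assumes simple: "simple_graph V E" and cubic: "cubic V E" and conn: "k_connected 3 V E"
    and S: "S \<subseteq> V" "S \<noteq> {}" "S \<noteq> V"
  shows "3 \<le> card (boundary E S)"
proof (rule ccontr)
  assume small: "\<not> 3 \<le> card (boundary E S)"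
  have edge: "\<exists>u v. u \<noteq> v \<and> u \<in> V \<and> v \<in> V \<and> e = {u, v}" if "e \<in> E" for e
    using simple that by (simp add: simple_graph_def)
  have finV: "finite V" using simple by (simp add: simple_graph_def)
  have "E \<subseteq> Pow V" using edge by fastforce
  then have finE: "finite E" using finV by (meson finite_Pow_iff finite_subset)
  have deg: "card (boundary E {v}) = 3" if "v \<in> V" for v
    using cubic that by (simp add: cubic_def degree_def boundary_singleton[OF simple])
  have "\<exists>x. x \<in> e \<and> x \<in> S" if "e \<in> boundary E S" for e using that by (auto simp: boundary_def)
  then obtain f where f: "\<And>e. e \<in> boundary E S \<Longrightarrow> f e \<in> e \<and> f e \<in> S" by metis
  define X where "X = f ` boundary E S"
  have finb: "finite (boundary E S)" using finE by (simp add: boundary_def)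
  then have cardX: "card X < 3" using card_image_le[of "boundary E S" f] small by (simp add: X_def)
  have XS: "X \<subseteq> S" using f by (auto simp: X_def)
  have "S \<subseteq> X"
  proof (rule ccontr)
    assume "\<not> S \<subseteq> X"
    then obtain s where s: "s \<in> S" "s \<notin> X" by blast
    obtain t where t: "t \<in> V" "t \<notin> S" using S by blast
    have "connected_on (V - X) E" using conn cardX XS S by (auto simp: k_connected_def)
    then have "reachable (V - X) E s t" using s t S XS by (auto simp: connected_on_def)
    then have "t \<in> S"
    proof (induction rule: reachable_induct)
      case (step y z)
      show "z \<in> S"
      proof (rule ccontr)
        assume "z \<notin> S"
        then have b: "{y, z} \<in> boundary E S" using step by (auto simp: boundary_def)
        then have "f {y, z} = y" using f[OF b] \<open>z \<notin> S\<close> by auto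
        then have "y \<in> X" using b unfolding X_def by (metis imageI)
        then show False using step by auto
      qed
    qed (fact s(1))
    then show False using t by simp
  qed
  then have "S = X" using XS by blast
  then have "card S < 3" "finite S" using cardX finV S finite_subset by auto
  moreover have "card S \<noteq> 0" using S \<open>finite S\<close> by auto
  ultimately consider "card S = 1" | "card S = 2" by linarith
  then show False
  proof cases
    case 1
    then obtain v where "S = {v}" by (rule card_1_singletonE)
    then show False using deg[of v] small S by simp
  next
    case 2
    then obtain x y where xy: "S = {x, y}" "x \<noteq> y" by (auto simp: card_2_iff)
    \<comment> \<open>At most one of the three edges at each of \<open>x\<close> and
      \<open>y\<close> joins them, so at least 2 + 2 edges leave \<open>S\<close>.\<close>
    have "(boundary E {x} - {{x, y}}) \<union> (boundary E {y} - {{x, y}}) \<subseteq> boundary E S"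
    proof
      fix e assume e: "e \<in> (boundary E {x} - {{x, y}}) \<union> (boundary E {y} - {{x, y}})"
      then have "e \<in> E" by (auto simp: boundary_def)
      then obtain u v where "u \<noteq> v" "e = {u, v}" using edge by blast
      then show "e \<in> boundary E S" using e xy by (auto simp: boundary_def)
    qed
    then have "card ((boundary E {x} - {{x, y}}) \<union> (boundary E {y} - {{x, y}})) \<le> card (boundary E S)"
      using finb by (intro card_mono)
    moreover have "card ((boundary E {x} - {{x, y}}) \<union> (boundary E {y} - {{x, y}})) =
        card (boundary E {x} - {{x, y}}) + card (boundary E {y} - {{x, y}})"
    proof (rule card_Un_disjoint)
      show "finite (boundary E {x} - {{x, y}})" "finite (boundary E {y} - {{x, y}})"
        using finE by (auto simp: boundary_def)
      show "(boundary E {x} - {{x, y}}) \<inter> (boundary E {y} - {{x, y}}) = {}"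
      proof (rule equals0I)
        fix e assume e: "e \<in> (boundary E {x} - {{x, y}}) \<inter> (boundary E {y} - {{x, y}})"
        then have "e \<in> E" "x \<in> e" "y \<in> e" by (auto simp: boundary_def)
        then obtain u v where "u \<noteq> v" "e = {u, v}" using edge by blast
        then have "e = {x, y}" using \<open>x \<in> e\<close> \<open>y \<in> e\<close> xy(2) by auto
        then show False using e by blast
      qed
    qed
    moreover have "2 \<le> card (boundary E {v} - {{x, y}})" if "v \<in> V" for v
      using diff_card_le_card_Diff[of "{{x, y}}" "boundary E {v}"] deg[OF that] by simp
    moreover from this have "2 \<le> card (boundary E {x} - {{x, y}})" "2 \<le> card (boundary E {y} - {{x, y}})"
      using S(1) xy(1) by auto
    ultimately show False using small by linarith
  qed
qed

text \<open>The \<open>LEAST\<close> in \<open>treewidth\<close> is attained as soon as some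
  decomposition exists; a single bag \<open>V\<close> is one.\<close>

lemma treewidth_decomposition:
  assumes "simple_graph V E" and "V \<noteq> {}"
  shows "\<exists>I F B. tree_decomposition V E I F B \<and> td_width I B = treewidth V E"
proof -
  have "tree_decomposition V E {0} {} (\<lambda>_. V)"
    using assms unfolding tree_decomposition_def is_tree_def simple_graph_def connected_on_def
      acyclic_on_def by (auto simp: reachable_refl)
  then have "\<exists>k. \<exists>I F B. tree_decomposition V E I F B \<and> td_width I B = k" by blast
  then show ?thesis unfolding treewidth_def by (rule LeastI_ex)
qed

lemma valid_degree:
  assumes simple: "simple_graph V E" and valid: "valid L (boundary E {v})"
  shows "degree {e \<in> E. L e = Cycle} v = 0 \<or> degree {e \<in> E. L e = Cycle} v = 2"
    and "degree {e \<in> E. L e = Matching} v \<le> 1"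
proof -
  obtain a b c where abc: "{e \<in> E. v \<in> e} = {a, b, c}" "a \<noteq> b" "a \<noteq> c" "b \<noteq> c"
    and o: "ordered_labels L a b c"
    using valid unfolding valid_def boundary_singleton[OF simple] by (elim exE conjE)
  have "{e \<in> {e \<in> E. L e = l}. v \<in> e} = {e. e \<in> {e \<in> E. v \<in> e} \<and> L e = l}" for l by auto
  then have "degree {e \<in> E. L e = l} v = card {e. e \<in> {a, b, c} \<and> L e = l}" for l
    by (simp only: degree_def abc(1))
  \<comment> \<open>As a union of conditional singletons the set has a cardinality that
    simplification computes for each label pattern.\<close>
  moreover have "{e. e \<in> {a, b, c} \<and> L e = l} =
      (if L a = l then {a} else {}) \<union> (if L b = l then {b} else {}) \<union> (if L c = l then {c} else {})"
    for l by auto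
  ultimately have deg: "degree {e \<in> E. L e = l} v = card
      ((if L a = l then {a} else {}) \<union> (if L b = l then {b} else {}) \<union> (if L c = l then {c} else {}))"
    for l by simp
  from o consider "L a = Tree" "L b = Tree" "L c = Tree" | "L a = Tree" "L b = Tree" "L c = Matching"
    | "L a = Tree" "L b = Cycle" "L c = Cycle"
    unfolding ordered_labels_def by blast
  then have "(degree {e \<in> E. L e = Cycle} v = 0 \<or> degree {e \<in> E. L e = Cycle} v = 2) \<and>
      degree {e \<in> E. L e = Matching} v \<le> 1"
    using abc(4) unfolding deg by cases simp_all
  then show "degree {e \<in> E. L e = Cycle} v = 0 \<or> degree {e \<in> E. L e = Cycle} v = 2"
    "degree {e \<in> E. L e = Matching} v \<le> 1" by simp_all
qed

theorem theorem5:
  fixes V :: "'a set" and E :: "'a set set"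
  assumes "simple_graph V E"
    and "cubic V E"
    and "k_connected 3 V E"
    and "treewidth V E = 3"
  shows "three_decomposition V E"
proof -
  have large: "3 < card V" using assms(3) by (simp add: k_connected_def)
  have finV: "finite V" using assms(1) by (simp add: simple_graph_def)
  have "V \<noteq> {}" using large by auto
  from treewidth_decomposition[OF assms(1) this]
  obtain I F B where td: "tree_decomposition V E I F B" and tw: "td_width I B = 3"
    unfolding assms(4) by (elim exE conjE)
  have "finite I" using td by (simp add: tree_decomposition_def is_tree_def simple_graph_def)
  \<comment> \<open>\<open>td_width\<close> is the largest bag size minus 1, so width 3 gives the
    bound 4 on which the bag arguments rest.\<close>
  have width: "card (B i) \<le> 4" if "i \<in> I" for i
  proof -
    have "card (B i) \<le> Max ((\<lambda>i. card (B i)) ` I)"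
      using \<open>finite I\<close> that by (intro Max_ge) auto
    then show ?thesis using tw unfolding td_width_def by linarith
  qed
  have card_edge: "card e = 2" if "e \<in> E" for e
    using assms(1) that unfolding simple_graph_def card_2_iff by metis
  define P where "P = (\<lambda>v. {v}) ` V"
  have "good_partition V E P"
  proof
    show "good E A" if A: "A \<in> P" for A
    proof -
      obtain v where v: "v \<in> V" "A = {v}" using A by (auto simp: P_def)
      then have "card (boundary E {v}) = 3"
        using assms(2) by (simp add: cubic_def degree_def boundary_singleton[OF assms(1)])
      then show ?thesis unfolding v using card_edge by (rule good_singleton)
    qed
  qed (use assms three_connected_cut[OF assms(1-3)] in \<open>auto simp: P_def\<close>)
  moreover have "card P = card V" by (simp add: P_def card_image)
  \<comment> \<open>The constant labelling is a dummy, since \<open>V\<close> has no boundary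
    edges.\<close>
  ultimately obtain L where L: "extension E (\<lambda>_. Tree) V L"
    using good_partition_extension[OF _ _ td width] large by fastforce
  let ?T = "{e \<in> E. L e = Tree}"
  have "e \<subseteq> V" if "e \<in> E" for e using assms(1) that unfolding simple_graph_def by fastforce
  then have T: "tree_edges E L V = ?T" by (auto simp: tree_edges_def)
  have simpleT: "simple_graph V ?T" using assms(1) by (simp add: simple_graph_def)
  have "E \<subseteq> Pow V" using \<open>\<And>e. e \<in> E \<Longrightarrow> e \<subseteq> V\<close> by blast
  then have "finite E" using finV by (meson finite_Pow_iff finite_subset)
  then have "finite ?T" by simp
  \<comment> \<open>\<open>extension\<close> records connectedness and an edge count; acyclicity is
    recovered from these here.\<close>
  then have "is_tree V ?T"
    using L simpleT connected_few_edges_acyclic[of V ?T] finV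
    by (simp add: is_tree_def extension_def T)
  moreover have "?T \<union> {e \<in> E. L e = Cycle} \<union> {e \<in> E. L e = Matching} = E"
    using label.exhaust by blast
  moreover have "?T \<inter> {e \<in> E. L e = Cycle} = {}" "?T \<inter> {e \<in> E. L e = Matching} = {}"
    "{e \<in> E. L e = Cycle} \<inter> {e \<in> E. L e = Matching} = {}" by auto
  moreover have "valid L (boundary E {v})" if "v \<in> V" for v
    using L that by (simp add: extension_def)
  then have "\<forall>v\<in>V. degree {e \<in> E. L e = Cycle} v = 0 \<or> degree {e \<in> E. L e = Cycle} v = 2"
    "\<forall>v\<in>V. degree {e \<in> E. L e = Matching} v \<le> 1"
    using valid_degree[OF assms(1)] by simp_all
  ultimately show ?thesis
    unfolding three_decomposition_def
    by (intro exI[of _ ?T] exI[of _ "{e \<in> E. L e = Cycle}"] exI[of _ "{e \<in> E. L e = Matching}"] conjI)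
qed

end
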